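(* Let $\mathcal{H}_d$ be a $d$-dimensional complex Hilbert space and let $\Phi$ be a quantum channel on $\mathrm{L}(\mathcal{H}_d)$ with Kraus operator space $K(\Phi)$ such that $K(\Phi)\cap \mathrm{U}(\mathcal{H}_d)=\emptyset$. Then the minimum $$C_\Phi=\min_{L\in K(\Phi)}\frac{\mathrm{Tr}\,\big((|L|-I_d)^2\big)}{d}$$ satisfies $$D\big(\Phi,\mathrm{Conv}(\mathbb{U}(\mathcal{H}_d))\big)\ \ge\ C_\Phi\ >\ 0 .$$
   Context: $\mathrm{L}(\mathcal{H})$ is the space of linear operators on the finite-dimensional complex Hilbert space $\mathcal{H}$; $\mathrm{U}(\mathcal{H})$ is the set of unitary operators on $\mathcal{H}$; $|L|=\sqrt{L^\dagger L}$; $I_d$ is the identity on $\mathcal{H}_d$. A quantum channel on $\mathrm{L}(\mathcal{H})$ is a completely positive trace-preserving linear map $\Phi:\mathrm{L}(\mathcal{H})\to\mathrm{L}(\mathcal{H})$; it has a Kraus representation $\Phi(X)=\sum_k E_kXE_k^\dagger$ with $\sum_k E_k^\dagger E_k=I$, and its Kraus operator space is $K(\Phi)=\mathrm{span}_{\mathbb{C}}\{E_k\}$ (independent of the chosen representation). $\mathbb{U}(\mathcal{H})$ is the set of unitary channels $X\mapsto UXU^\dagger$, $U\in\mathrm{U}(\mathcal{H})$, and $\mathrm{Conv}(\mathbb{U}(\mathcal{H}))$ is its convex hull. For a linear map $\Phi$ on $\mathrm{L}(\mathcal{H})$, $\|\Phi\|_1=\sup_{\|X\|_1\le 1}\|\Phi(X)\|_1$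 with $\|X\|_1=\mathrm{Tr}|X|$, and the diamond norm is $\|\Phi\|_\diamond=\sup_{n\ge1}\|\Phi\otimes \mathrm{id}_{\mathrm{L}(\mathbb{C}^n)}\|_1$. The distance between channels is $D(\Phi,\Psi)=\|\Phi-\Psi\|_\diamond$, and $D(\Phi,\mathcal{S})=\inf_{\Psi\in\mathcal{S}}D(\Phi,\Psi)$ for a set $\mathcal{S}$ of channels. *)

theory Defs
  imports
    "Jordan_Normal_Form.Schur_Decomposition"
    "Jordan_Normal_Form.VS_Connect"
    "HOL-Library.Extended_Real"
begin

text \<open>
  The Hilbert space of dimension \<open>d\<close> is \<open>\<complex>\<^sup>d\<close> and its operators are the matrices in
  \<open>carrier_mat d d\<close>. Maps between operator spaces are HOL functions on matrices of which only
  the values on the relevant carrier matter.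
\<close>

abbreviation op_space :: "nat \<Rightarrow> (complex, complex mat) module" where
  "op_space d \<equiv> module_mat TYPE(complex) d d"

definition mat_trace :: "complex mat \<Rightarrow> complex" where
  "mat_trace A = (\<Sum>i<dim_row A. A $$ (i, i))"

definition unitary_ops :: "nat \<Rightarrow> complex mat set" where
  "unitary_ops d = {U \<in> carrier_mat d d. mat_adjoint U * U = 1\<^sub>m d \<and> U * mat_adjoint U = 1\<^sub>m d}"

text \<open>
  The order on \<open>complex\<close> makes \<open>0 \<le> z\<close> say that \<open>z\<close> is real and nonnegative,
  so Hermiticity is implied.
\<close>

definition positive_op :: "nat \<Rightarrow> complex mat \<Rightarrow> bool" where
  "positive_op d A \<longleftrightarrow> A \<in> carrier_mat d d \<and> (\<forall>v\<in>carrier_vec d. 0 \<le> (A *\<^sub>v v) \<bullet>c v)"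

definition mat_sqrt :: "complex mat \<Rightarrow> complex mat" where
  "mat_sqrt A = (THE P. positive_op (dim_row A) P \<and> P * P = A)"

definition mat_abs :: "complex mat \<Rightarrow> complex mat" where
  "mat_abs L = mat_sqrt (mat_adjoint L * L)"

text \<open>\<open>Tr|X|\<close> is a nonnegative real, so taking the real part only changes the type.\<close>

definition trace_norm :: "complex mat \<Rightarrow> real" where
  "trace_norm X = Re (mat_trace (mat_abs X))"

text \<open>
  \<open>\<complex>\<^sup>d \<otimes> \<complex>\<^sup>n\<close> is \<open>\<complex>\<^bsup>dn\<^esup>\<close> with \<open>e\<^sub>i \<otimes> e\<^sub>a\<close> the basis vector
  of index \<open>i * n + a\<close> (\<open>i < d\<close>, \<open>a < n\<close>). Writing an operator on it as
  \<open>\<Sum>\<^sub>a\<^sub>b X\<^sub>a\<^sub>b \<otimes> |a\<rangle>\<langle>b|\<close>, the map \<open>\<Phi> \<otimes> id\<close> applies \<open>\<Phi>\<close> to each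
  \<open>X\<^sub>a\<^sub>b\<close>; see \<open>ampliation_tensor_op\<close> below.
\<close>

definition tensor_op :: "nat \<Rightarrow> nat \<Rightarrow> complex mat \<Rightarrow> complex mat \<Rightarrow> complex mat" where
  "tensor_op d n A B = mat (d * n) (d * n)
     (\<lambda>(r, c). A $$ (r div n, c div n) * B $$ (r mod n, c mod n))"

definition slot_block :: "nat \<Rightarrow> nat \<Rightarrow> complex mat \<Rightarrow> nat \<Rightarrow> nat \<Rightarrow> complex mat" where
  "slot_block d n X a b = mat d d (\<lambda>(i, j). X $$ (i * n + a, j * n + b))"

definition ampliation :: "nat \<Rightarrow> nat \<Rightarrow> (complex mat \<Rightarrow> complex mat) \<Rightarrow> complex mat \<Rightarrow> complex mat" where
  "ampliation d n \<Phi> X = mat (d * n) (d * n)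
     (\<lambda>(r, c). \<Phi> (slot_block d n X (r mod n) (c mod n)) $$ (r div n, c div n))"

definition completely_positive :: "nat \<Rightarrow> (complex mat \<Rightarrow> complex mat) \<Rightarrow> bool" where
  "completely_positive d \<Phi> \<longleftrightarrow>
     (\<forall>n\<ge>1. \<forall>X. positive_op (d * n) X \<longrightarrow> positive_op (d * n) (ampliation d n \<Phi> X))"

definition trace_preserving :: "nat \<Rightarrow> (complex mat \<Rightarrow> complex mat) \<Rightarrow> bool" where
  "trace_preserving d \<Phi> \<longleftrightarrow> (\<forall>X\<in>carrier_mat d d. mat_trace (\<Phi> X) = mat_trace X)"

definition quantum_channel :: "nat \<Rightarrow> (complex mat \<Rightarrow> complex mat) \<Rightarrow> bool" where
  "quantum_channel d \<Phi> \<longleftrightarrow>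
     \<Phi> \<in> LinearCombinations.module_hom class_ring (op_space d) (op_space d) \<and>
     completely_positive d \<Phi> \<and> trace_preserving d \<Phi>"

definition kraus_rep :: "nat \<Rightarrow> (complex mat \<Rightarrow> complex mat) \<Rightarrow> complex mat list \<Rightarrow> bool" where
  "kraus_rep d \<Phi> Es \<longleftrightarrow> set Es \<subseteq> carrier_mat d d \<and>
     (\<forall>X\<in>carrier_mat d d.
        \<Phi> X = finsum (op_space d) (\<lambda>k. Es ! k * X * mat_adjoint (Es ! k)) {..<length Es}) \<and>
     finsum (op_space d) (\<lambda>k. mat_adjoint (Es ! k) * Es ! k) {..<length Es} = 1\<^sub>m d"

text \<open>
  Every channel has a Kraus representation and the span does not depend on which one is chosen.
\<close>

definition kraus_space :: "nat \<Rightarrow> (complex mat \<Rightarrow> complex mat) \<Rightarrow> complex mat set" where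
  "kraus_space d \<Phi> = LinearCombinations.module.span class_ring (op_space d)
     (set (SOME Es. kraus_rep d \<Phi> Es))"

definition unitary_channels :: "nat \<Rightarrow> (complex mat \<Rightarrow> complex mat) set" where
  "unitary_channels d = {(\<lambda>X. U * X * mat_adjoint U) | U. U \<in> unitary_ops d}"

text \<open>
  Matrix types carry no \<open>real_vector\<close> structure, so the convex hull is spelled out as the set
  of finite convex combinations (up to values outside \<open>carrier_mat d d\<close>).
\<close>

definition map_convex_hull ::
    "nat \<Rightarrow> (complex mat \<Rightarrow> complex mat) set \<Rightarrow> (complex mat \<Rightarrow> complex mat) set" where
  "map_convex_hull d S = {\<Psi>. \<exists>(m::nat) (p :: nat \<Rightarrow> real) F.
     (\<forall>k<m. 0 \<le> p k \<and> F k \<in> S) \<and> (\<Sum>k<m. p k) = 1 \<and>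
     (\<forall>X\<in>carrier_mat d d.
        \<Psi> X = finsum (op_space d) (\<lambda>k. complex_of_real (p k) \<cdot>\<^sub>m F k X) {..<m})}"

text \<open>
  The suprema are taken in \<open>ereal\<close>, where they exist without a boundedness argument.
\<close>

definition induced_trace_norm :: "nat \<Rightarrow> (complex mat \<Rightarrow> complex mat) \<Rightarrow> ereal" where
  "induced_trace_norm N T =
     (SUP X \<in> {X \<in> carrier_mat N N. trace_norm X \<le> 1}. ereal (trace_norm (T X)))"

definition diamond_norm :: "nat \<Rightarrow> (complex mat \<Rightarrow> complex mat) \<Rightarrow> ereal" where
  "diamond_norm d T = (SUP n \<in> {1..}. induced_trace_norm (d * n) (ampliation d n T))"

definition channel_dist ::
    "nat \<Rightarrow> (complex mat \<Rightarrow> complex mat) \<Rightarrow> (complex mat \<Rightarrow> complex mat) \<Rightarrow> ereal" where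
  "channel_dist d \<Phi> \<Psi> = diamond_norm d (\<lambda>X. \<Phi> X - \<Psi> X)"

definition channel_setdist ::
    "nat \<Rightarrow> (complex mat \<Rightarrow> complex mat) \<Rightarrow> (complex mat \<Rightarrow> complex mat) set \<Rightarrow> ereal" where
  "channel_setdist d \<Phi> S = (INF \<Psi> \<in> S. channel_dist d \<Phi> \<Psi>)"

text \<open>\<open>Tr((|L| - I)\<^sup>2) / d\<close>; the trace is real because \<open>|L|\<close> is Hermitian.\<close>

definition unitarity_defect :: "nat \<Rightarrow> complex mat \<Rightarrow> real" where
  "unitarity_defect d L = Re (mat_trace ((mat_abs L - 1\<^sub>m d) ^\<^sub>m 2)) / real d"

lemma ampliation_tensor_op:
  assumes lin: "\<Phi> \<in> LinearCombinations.module_hom class_ring (op_space d) (op_space d)"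
    and A: "A \<in> carrier_mat d d"
  shows "ampliation d n \<Phi> (tensor_op d n A B) = tensor_op d n (\<Phi> A) B"
proof (rule eq_matI)
  fix r c assume "r < dim_row (tensor_op d n (\<Phi> A) B)" "c < dim_col (tensor_op d n (\<Phi> A) B)"
  then have r: "r < d * n" and c: "c < d * n" by (auto simp: tensor_op_def)
  then have n: "0 < n" by (cases n) auto
  have rc: "r div n < d" "c div n < d" "r mod n < n" "c mod n < n"
    using r c n by (auto simp: less_mult_imp_div_less)
  have bound: "i * n + a < d * n" if "i < d" "a < n" for i a
  proof -
    have "i * n + a < Suc i * n" using that by simp
    also have "\<dots> \<le> d * n" using that by (intro mult_le_mono1) simp
    finally show ?thesis .
  qed
  have "slot_block d n (tensor_op d n A B) (r mod n) (c mod n)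
      = B $$ (r mod n, c mod n) \<cdot>\<^sub>m A"
    by (rule eq_matI) (use A rc bound in \<open>auto simp: slot_block_def tensor_op_def\<close>)
  moreover have "\<Phi> (B $$ (r mod n, c mod n) \<cdot>\<^sub>m A) = B $$ (r mod n, c mod n) \<cdot>\<^sub>m \<Phi> A"
    using lin A by (auto simp: LinearCombinations.module_hom_def module_mat_simps class_ring_simps)
  moreover have "\<Phi> A \<in> carrier_mat d d"
    using lin A by (auto simp: LinearCombinations.module_hom_def module_mat_simps)
  ultimately show "ampliation d n \<Phi> (tensor_op d n A B) $$ (r, c) = tensor_op d n (\<Phi> A) B $$ (r, c)"
    using r c rc by (auto simp: ampliation_def tensor_op_def)
qed (auto simp: ampliation_def tensor_op_def)

end

theory Submission
  imports Defs "HOL-Analysis.L2_Norm" "Jordan_Normal_Form.Spectral_Radius"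
begin

text \<open>
  Let \<open>P\<close> be the projection of \<open>\<complex>\<^sup>d \<otimes> \<complex>\<^sup>d\<close> onto the vectorized Kraus space, i.e. onto the range of
  the Choi matrix of \<open>\<Phi>\<close>. Testing the difference of the Choi states of \<open>\<Phi>\<close> and of a mixture
  \<open>\<Sum>\<^sub>k p\<^sub>k U\<^sub>k \<sqdot> U\<^sub>k\<^sup>H\<close> against \<open>P - 1\<close> bounds their distance from below by
  \<open>\<Sum>\<^sub>k p\<^sub>k (d - \<langle>P U\<^sub>k, U\<^sub>k\<rangle>) / d\<close>.

  Since \<open>Tr |L| = max Re \<langle>L, Q\<rangle>\<close> over contractions \<open>Q\<close>, the defect \<open>d \<sqdot> C\<^sub>\<Phi>\<close> is the minimum of
  \<open>\<parallel>L\<parallel>\<^sup>2 - 2 Re \<langle>L, Q\<rangle> + d\<close> over \<open>L\<close> in the Kraus space and contractions \<open>Q\<close>. For fixed \<open>Q\<close> the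
  optimal \<open>L\<close> is \<open>P Q\<close>, with value \<open>d - \<langle>P Q, Q\<rangle>\<close>, so only the compact set of contractions has to be
  searched; unitaries are contractions, which gives the bound. The minimum vanishes only if the
  optimal \<open>Q\<close> lies in the Kraus space and satisfies \<open>Tr Q\<^sup>H Q = d\<close>, which makes it unitary. Working
  with contractions instead of unitaries avoids completing the partial isometry in the polar
  decomposition.
\<close>

notation mat_adjoint ("_\<^sup>H" [1000] 1000)

subsection \<open>Adjoints, inner products and traces\<close>

lemma dim_adjoint [simp]: "dim_row (A\<^sup>H) = dim_col A" "dim_col (A\<^sup>H) = dim_row A"
  by (auto simp: mat_adjoint_def)

lemma adjoint_carrier [simp]: "A \<in> carrier_mat n m \<Longrightarrow> A\<^sup>H \<in> carrier_mat m n"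
  by (auto intro: carrier_matI)

lemma adjoint_index [simp]:
  fixes A :: "complex mat"
  shows "i < dim_col A \<Longrightarrow> j < dim_row A \<Longrightarrow> A\<^sup>H $$ (i, j) = cnj (A $$ (j, i))"
  by (simp add: mat_adjoint_def mat_of_rows_def)

lemma adjoint_adjoint [simp]: "(A\<^sup>H)\<^sup>H = (A :: complex mat)"
  by (rule eq_matI) auto

lemma mult_mat_index_sum:
  "A \<in> carrier_mat n k \<Longrightarrow> B \<in> carrier_mat k m \<Longrightarrow> i < n \<Longrightarrow> j < m \<Longrightarrow>
    (A * B) $$ (i, j) = (\<Sum>l<k. A $$ (i, l) * B $$ (l, j))"
  by (auto simp: scalar_prod_def atLeast0LessThan intro!: sum.cong)

lemma mult_mat_vec_index_sum:
  "A \<in> carrier_mat n m \<Longrightarrow> v \<in> carrier_vec m \<Longrightarrow> i < n \<Longrightarrow>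
    (A *\<^sub>v v) $ i = (\<Sum>l<m. A $$ (i, l) * v $ l)"
  by (auto simp: scalar_prod_def atLeast0LessThan intro!: sum.cong)

lemma cscalar_prod_sum:
  fixes x y :: "complex vec"
  shows "y \<in> carrier_vec n \<Longrightarrow> x \<bullet>c y = (\<Sum>i<n. x $ i * cnj (y $ i))"
  by (auto simp: scalar_prod_def atLeast0LessThan intro!: sum.cong)

lemma adjoint_mult:
  fixes A :: "complex mat"
  assumes "A \<in> carrier_mat n k" "B \<in> carrier_mat k m"
  shows "(A * B)\<^sup>H = B\<^sup>H * A\<^sup>H"
proof (rule eq_matI)
  fix i j assume "i < dim_row (B\<^sup>H * A\<^sup>H)" "j < dim_col (B\<^sup>H * A\<^sup>H)"
  then have ij: "i < m" "j < n" using assms by auto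
  have "(A * B)\<^sup>H $$ (i, j) = cnj ((A * B) $$ (j, i))"
    using assms ij by (intro adjoint_index) auto
  also have "\<dots> = (\<Sum>l<k. B\<^sup>H $$ (i, l) * A\<^sup>H $$ (l, j))"
    using assms ij by (subst mult_mat_index_sum[OF assms]) (auto intro!: sum.cong)
  also have "\<dots> = (B\<^sup>H * A\<^sup>H) $$ (i, j)"
    using assms ij by (subst mult_mat_index_sum[of _ m k _ n]) auto
  finally show "(A * B)\<^sup>H $$ (i, j) = (B\<^sup>H * A\<^sup>H) $$ (i, j)" .
qed (use assms in auto)

lemma adjoint_minus:
  fixes A :: "complex mat"
  assumes "A \<in> carrier_mat n m" "B \<in> carrier_mat n m"
  shows "(A - B)\<^sup>H = A\<^sup>H - B\<^sup>H"
  by (rule eq_matI) (use assms in auto)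

lemma adjoint_one [simp]: "(1\<^sub>m n)\<^sup>H = (1\<^sub>m n :: complex mat)"
  by (rule eq_matI) auto

lemma cscalar_prod_adjoint:
  fixes A :: "complex mat"
  assumes A: "A \<in> carrier_mat n m" and v: "v \<in> carrier_vec m" and w: "w \<in> carrier_vec n"
  shows "(A *\<^sub>v v) \<bullet>c w = v \<bullet>c (A\<^sup>H *\<^sub>v w)"
proof -
  have "(A *\<^sub>v v) \<bullet>c w = (\<Sum>i<n. \<Sum>l<m. A $$ (i, l) * v $ l * cnj (w $ i))"
    using assms by (simp add: cscalar_prod_sum mult_mat_vec_index_sum sum_distrib_right del: index_mult_mat_vec)
  also have "\<dots> = (\<Sum>l<m. \<Sum>i<n. A $$ (i, l) * v $ l * cnj (w $ i))"
    by (rule sum.swap)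
  also have "\<dots> = (\<Sum>l<m. v $ l * cnj ((A\<^sup>H *\<^sub>v w) $ l))"
    using A w by (intro sum.cong refl)
      (simp add: mult_mat_vec_index_sum[of "A\<^sup>H" m n] sum_distrib_left mult_ac del: index_mult_mat_vec)
  also have "\<dots> = v \<bullet>c (A\<^sup>H *\<^sub>v w)"
    using mult_mat_vec_carrier[OF adjoint_carrier[OF A] w] by (subst cscalar_prod_sum[of _ m]) auto
  finally show ?thesis .
qed

lemma cscalar_prod_commute:
  fixes x y :: "complex vec"
  assumes "x \<in> carrier_vec n" "y \<in> carrier_vec n"
  shows "y \<bullet>c x = cnj (x \<bullet>c y)"
  using assms by (simp add: cscalar_prod_sum mult_ac)

lemma Re_cscalar_prod_self:
  assumes "x \<in> carrier_vec n"
  shows "Re (x \<bullet>c x) = (\<Sum>i<n. (cmod (x $ i))\<^sup>2)"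
  using assms by (simp add: cscalar_prod_sum complex_mult_cnj cmod_power2)

lemma cscalar_prod_self:
  fixes x :: "complex vec"
  assumes "x \<in> carrier_vec n"
  shows "x \<bullet>c x = complex_of_real (Re (x \<bullet>c x))"
  using assms by (simp add: cscalar_prod_sum complex_mult_cnj)

lemma Re_cscalar_prod_self_ge_0: "x \<in> carrier_vec n \<Longrightarrow> 0 \<le> Re (x \<bullet>c (x :: complex vec))"
  by (simp add: Re_cscalar_prod_self sum_nonneg)

text \<open>The triangle inequality reduces the complex case to the real Cauchy-Schwarz inequality
  for the moduli of the entries.\<close>

lemma Cauchy_Schwarz_cscalar_prod:
  fixes x y :: "complex vec"
  assumes x: "x \<in> carrier_vec n" and y: "y \<in> carrier_vec n"
  shows "Re (x \<bullet>c y) \<le> sqrt (Re (x \<bullet>c x)) * sqrt (Re (y \<bullet>c y))"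
proof -
  have "Re (x \<bullet>c y) \<le> cmod (x \<bullet>c y)" by (rule complex_Re_le_cmod)
  also have "\<dots> \<le> (\<Sum>i<n. \<bar>cmod (x $ i)\<bar> * \<bar>cmod (y $ i)\<bar>)"
    unfolding cscalar_prod_sum[OF y] by (rule sum_norm_le) (simp add: norm_mult)
  also have "\<dots> \<le> L2_set (\<lambda>i. cmod (x $ i)) {..<n} * L2_set (\<lambda>i. cmod (y $ i)) {..<n}"
    by (rule L2_set_mult_ineq)
  also have "\<dots> = sqrt (Re (x \<bullet>c x)) * sqrt (Re (y \<bullet>c y))"
    using x y by (simp add: L2_set_def Re_cscalar_prod_self)
  finally show ?thesis .
qed

lemma mat_trace_sum: "A \<in> carrier_mat n n \<Longrightarrow> mat_trace A = (\<Sum>i<n. A $$ (i, i))"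
  by (auto simp: mat_trace_def)

lemma mat_trace_diff:
  "A \<in> carrier_mat n n \<Longrightarrow> B \<in> carrier_mat n n \<Longrightarrow> mat_trace (A - B) = mat_trace A - mat_trace B"
  by (auto simp: mat_trace_def sum_subtractf)

lemma mat_trace_one [simp]: "mat_trace (1\<^sub>m n) = of_nat n"
  by (simp add: mat_trace_def)

lemma mat_trace_mult_commute:
  assumes A: "A \<in> carrier_mat n m" and B: "B \<in> carrier_mat m n"
  shows "mat_trace (A * B) = mat_trace (B * A)"
proof -
  have "mat_trace (A * B) = (\<Sum>i<n. \<Sum>l<m. A $$ (i, l) * B $$ (l, i))"
    using assms by (subst mat_trace_sum[of _ n]) (auto simp: mult_mat_index_sum simp del: index_mult_mat)
  also have "\<dots> = (\<Sum>l<m. \<Sum>i<n. B $$ (l, i) * A $$ (i, l))"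
    by (subst sum.swap) (simp add: mult_ac)
  also have "\<dots> = mat_trace (B * A)"
    using assms by (subst mat_trace_sum[of _ m]) (auto simp: mult_mat_index_sum simp del: index_mult_mat)
  finally show ?thesis .
qed

text \<open>Summing over columns allows the Hilbert-Schmidt pairing to be estimated vector by
  vector, once both factors are expressed in a suitable orthonormal basis.\<close>

lemma mat_trace_adjoint_mult:
  assumes "A \<in> carrier_mat n m" and "B \<in> carrier_mat n m"
  shows "mat_trace (A\<^sup>H * B) = (\<Sum>i<m. col B i \<bullet>c col A i)"
  using assms
  by (subst mat_trace_sum[of _ m])
    (auto simp: mult_mat_index_sum[of "A\<^sup>H" m n] cscalar_prod_sum[of _ n] mult_ac
      simp del: index_mult_mat(1) intro!: sum.cong)

text \<open>The diagonal entries of \<open>A * A\<^sup>H\<close> are the squared norms of the rows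
  of \<open>A\<close>.\<close>

lemma mult_adjoint_self_eq_0D:
  fixes A :: "complex mat"
  assumes A: "A \<in> carrier_mat n m" and 0: "A * A\<^sup>H = 0\<^sub>m n n"
  shows "A = 0\<^sub>m n m"
proof (rule eq_matI)
  fix i j assume "i < dim_row (0\<^sub>m n m)" "j < dim_col (0\<^sub>m n m)"
  then have ij: "i < n" "j < m" by auto
  have "0 = Re ((A * A\<^sup>H) $$ (i, i))" using 0 ij by simp
  also have "\<dots> = (\<Sum>l<m. (cmod (A $$ (i, l)))\<^sup>2)"
    using A ij by (subst mult_mat_index_sum[of A n m _ n])
      (auto simp: complex_mult_cnj cmod_power2 intro!: sum.cong)
  finally have "(cmod (A $$ (i, j)))\<^sup>2 = 0"
    using ij by (subst (asm) eq_commute) (subst (asm) sum_nonneg_eq_0_iff, auto)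
  then show "A $$ (i, j) = 0\<^sub>m n m $$ (i, j)" using ij by simp
qed (use A in auto)

subsection \<open>The spectral theorem\<close>

lemma unitary_opsI: "U \<in> carrier_mat n n \<Longrightarrow> U\<^sup>H * U = 1\<^sub>m n \<Longrightarrow> U \<in> unitary_ops n"
  using mat_mult_left_right_inverse[of "U\<^sup>H" n U] by (auto simp: unitary_ops_def)

lemma unitary_opsD:
  assumes "U \<in> unitary_ops n"
  shows "U \<in> carrier_mat n n" "U\<^sup>H * U = 1\<^sub>m n" "U * U\<^sup>H = 1\<^sub>m n"
  using assms by (auto simp: unitary_ops_def)

lemma unitary_ops_mult:
  assumes U: "U \<in> unitary_ops n" and V: "V \<in> unitary_ops n"
  shows "U * V \<in> unitary_ops n"
proof (rule unitary_opsI)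
  note [simp] = unitary_opsD[OF U] unitary_opsD[OF V]
  have "U\<^sup>H * (U * V) = V"
    by (subst assoc_mult_mat[symmetric, of _ n n _ n _ n]) (auto simp: left_mult_one_mat[of _ n n])
  then show "(U * V)\<^sup>H * (U * V) = 1\<^sub>m n"
    by (simp add: adjoint_mult[of _ n n _ n] assoc_mult_mat[of _ n n _ n _ n] mult_carrier_mat[of _ n n _ n])
qed (use unitary_opsD(1)[OF U] unitary_opsD(1)[OF V] in auto)

text \<open>Orthogonalizing a basis that starts with \<open>v\<close> keeps its first vector, and
  normalizing the columns makes the matrix unitary; \<open>c\<close> absorbs the normalization. This
  is the change of basis that splits off an eigenvector in the spectral theorem.\<close>

lemma unitary_completion:
  assumes v: "v \<in> carrier_vec n" "v \<noteq> 0\<^sub>v n"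
  shows "\<exists>W\<in>unitary_ops n. \<exists>c. col W 0 = c \<cdot>\<^sub>v v"
proof -
  interpret cof_vec_space n "TYPE(complex)" .
  define b where "b = basis_completion v"
  define ws where "ws = gram_schmidt n b"
  from basis_completion[OF v, folded b_def]
  have b: "distinct b" "\<not> lin_dep (set b)" "set b \<subseteq> carrier_vec n" "hd b = v" "length b = n"
    by auto
  have n: "n \<noteq> 0" using v by (auto intro!: eq_vecI)
  with b obtain vs where bv: "b = v # vs" by (cases b) auto
  from gram_schmidt_result[OF b(3) b(1) b(2) refl, folded ws_def] b
  have ws: "set ws \<subseteq> carrier_vec n" "corthogonal ws" "length ws = n" by auto
  from gram_schmidt_hd[OF v(1), of vs, folded bv] have "hd ws = v" by (simp add: ws_def)
  then have ws0: "ws ! 0 = v" using ws n by (cases ws) auto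
  \<comment> \<open>\<open>gram_schmidt\<close> yields orthogonal but not normalized vectors. The
    reciprocal norm \<open>s i\<close> is meaningful because \<open>corthogonal\<close> excludes
    zero vectors.\<close>
  define s where "s i = 1 / complex_of_real (sqrt (Re (ws ! i \<bullet>c ws ! i)))" for i
  define W where "W = mat_of_cols n (map (\<lambda>i. s i \<cdot>\<^sub>v ws ! i) [0..<n])"
  have W: "W \<in> carrier_mat n n" by (simp add: W_def mat_of_cols_def)
  have wsc: "ws ! i \<in> carrier_vec n" if "i < n" for i using ws that by auto
  have col: "col W i = s i \<cdot>\<^sub>v ws ! i" if "i < n" for i
    using that wsc unfolding W_def by (subst col_mat_of_cols) auto
  have "W\<^sup>H * W = 1\<^sub>m n"
  proof (rule eq_matI)
    fix i j assume "i < dim_row (1\<^sub>m n)" "j < dim_col (1\<^sub>m n)"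
    then have ij: "i < n" "j < n" by auto
    have "(W\<^sup>H * W) $$ (i, j) = col W j \<bullet>c col W i"
      using W ij by (subst mult_mat_index_sum[of _ n n])
        (auto simp: cscalar_prod_sum[of _ n] mult_ac intro!: sum.cong)
    also have "\<dots> = s j * cnj (s i) * (ws ! j \<bullet>c ws ! i)"
      using ij wsc[of i] wsc[of j] by (simp add: col cscalar_prod_sum sum_distrib_left mult_ac)
    also have "\<dots> = (if i = j then 1 else 0)"
    proof (cases "i = j")
      case True
      have "ws ! i \<bullet>c ws ! i \<noteq> 0" using ws ij by (simp add: corthogonalD)
      then have "Re (ws ! i \<bullet>c ws ! i) > 0"
        using Re_cscalar_prod_self_ge_0[OF wsc[OF ij(1)]] cscalar_prod_self[OF wsc[OF ij(1)]]
        by (cases "Re (ws ! i \<bullet>c ws ! i) = 0") auto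
      then have "s i * cnj (s i) * complex_of_real (Re (ws ! i \<bullet>c ws ! i)) = 1"
        by (simp add: s_def flip: of_real_mult)
      with True show ?thesis using cscalar_prod_self[OF wsc[OF ij(1)]] by simp
    next
      case False
      then have "ws ! j \<bullet>c ws ! i = 0" using ws ij by (subst corthogonalD) auto
      with False show ?thesis by simp
    qed
    finally show "(W\<^sup>H * W) $$ (i, j) = 1\<^sub>m n $$ (i, j)" using ij by simp
  qed (use W in auto)
  then have "W \<in> unitary_ops n" by (rule unitary_opsI[OF W])
  moreover have "col W 0 = s 0 \<cdot>\<^sub>v v" using n col[of 0] ws0 by simp
  ultimately show ?thesis by blast
qed

section \<open>Real diagonal and block diagonal matrices\<close>

definition real_diag :: "nat \<Rightarrow> (nat \<Rightarrow> real) \<Rightarrow> complex mat" where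
  "real_diag n l = mat n n (\<lambda>(i, j). if i = j then complex_of_real (l i) else 0)"

lemma real_diag_carrier [simp]: "real_diag n l \<in> carrier_mat n n"
  "dim_row (real_diag n l) = n" "dim_col (real_diag n l) = n"
  by (auto simp: real_diag_def)

lemma real_diag_index [simp]:
  "i < n \<Longrightarrow> j < n \<Longrightarrow> real_diag n l $$ (i, j) = (if i = j then complex_of_real (l i) else 0)"
  by (auto simp: real_diag_def)

lemma real_diag_mult: "real_diag n l * real_diag n k = real_diag n (\<lambda>i. l i * k i)"
proof (rule eq_matI)
  fix i j assume "i < dim_row (real_diag n (\<lambda>i. l i * k i))" "j < dim_col (real_diag n (\<lambda>i. l i * k i))"
  then have ij: "i < n" "j < n" by auto
  have "(real_diag n l * real_diag n k) $$ (i, j) = (\<Sum>a<n. real_diag n l $$ (i, a) * real_diag n k $$ (a, j))"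
    using ij by (subst mult_mat_index_sum[of _ n n]) auto
  also have "\<dots> = (\<Sum>a<n. if a = i then l i * real_diag n k $$ (i, j) else 0)"
    by (rule sum.cong) (use ij in auto)
  finally show "(real_diag n l * real_diag n k) $$ (i, j) = real_diag n (\<lambda>i. l i * k i) $$ (i, j)"
    using ij by simp
qed auto

lemma adjoint_real_diag [simp]: "(real_diag n l)\<^sup>H = real_diag n l"
  by (rule eq_matI) auto

lemma real_diag_one: "real_diag n (\<lambda>_. 1) = 1\<^sub>m n"
  by (rule eq_matI) auto

lemma adjoint_four_block_diag:
  fixes A :: "complex mat"
  assumes "A \<in> carrier_mat n n" "B \<in> carrier_mat m m"
  shows "(four_block_mat A (0\<^sub>m n m) (0\<^sub>m m n) B)\<^sup>H = four_block_mat (A\<^sup>H) (0\<^sub>m n m) (0\<^sub>m m n) (B\<^sup>H)"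
  by (rule eq_matI) (use assms in auto)

lemma mult_four_block_diag:
  fixes A :: "complex mat"
  assumes "A \<in> carrier_mat n n" "B \<in> carrier_mat m m" "C \<in> carrier_mat n n" "D \<in> carrier_mat m m"
  shows "four_block_mat A (0\<^sub>m n m) (0\<^sub>m m n) B * four_block_mat C (0\<^sub>m n m) (0\<^sub>m m n) D =
    four_block_mat (A * C) (0\<^sub>m n m) (0\<^sub>m m n) (B * D)"
  using assms by (subst mult_four_block_mat[of _ n n _ m _ m _ _ n _ m]) auto

text \<open>Deflation: conjugating by a unitary whose first column is an eigenvector splits off a
  block of size 1 and leaves a Hermitian matrix of size \<open>n\<close> for the induction
  hypothesis.\<close>

theorem hermitian_diagonalization:
  assumes "A \<in> carrier_mat n n" "A\<^sup>H = A"
  shows "\<exists>V\<in>unitary_ops n. \<exists>l. A = V * real_diag n l * V\<^sup>H"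
  using assms
proof (induction n arbitrary: A)
  case 0
  have "1\<^sub>m 0 \<in> unitary_ops 0" by (rule unitary_opsI) auto
  then show ?case using 0 by (intro bexI[of _ "1\<^sub>m 0"] exI[of _ "\<lambda>_. 0"]) (auto intro!: eq_matI)
next
  case (Suc n A)
  let ?N = "Suc n"
  note A = Suc.prems(1)
  obtain e where "eigenvalue A e"
    using spectrum_non_empty[OF A] by (auto simp: spectrum_def)
  then obtain v where v: "v \<in> carrier_vec ?N" "v \<noteq> 0\<^sub>v ?N" "A *\<^sub>v v = e \<cdot>\<^sub>v v"
    using A by (auto simp: eigenvalue_def eigenvector_def)
  obtain W c where W: "W \<in> unitary_ops ?N" and c: "col W 0 = c \<cdot>\<^sub>v v"
    using unitary_completion[OF v(1,2)] by blast
  note Wu = unitary_opsD[OF W]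
  define B where "B = W\<^sup>H * A * W"
  have B: "B \<in> carrier_mat ?N ?N"
    unfolding B_def using A Wu(1) by (intro mult_carrier_mat[of _ ?N ?N] adjoint_carrier)
  have BH: "B\<^sup>H = B"
    using A Wu Suc.prems(2)
    by (simp add: B_def adjoint_mult[of _ ?N ?N _ ?N] assoc_mult_mat[of _ ?N ?N _ ?N _ ?N]
        mult_carrier_mat[of _ ?N ?N _ ?N])
  have AWBW: "A = W * B * W\<^sup>H"
  proof -
    have "W * B * W\<^sup>H = (W * W\<^sup>H) * A * (W * W\<^sup>H)"
      using A Wu(1) by (simp add: B_def assoc_mult_mat[of _ ?N ?N _ ?N _ ?N] mult_carrier_mat[of _ ?N ?N _ ?N])
    then show ?thesis using A Wu by simp
  qed
  have w: "col W 0 \<in> carrier_vec ?N" using v by (simp add: c)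
  have "A *\<^sub>v col W 0 = e \<cdot>\<^sub>v col W 0"
    using A v by (simp add: c mult_mat_vec[of _ ?N ?N] smult_smult_assoc mult.commute)
  moreover have "col B 0 = W\<^sup>H *\<^sub>v (A *\<^sub>v col W 0)"
    using A Wu(1) w unfolding B_def
    by (subst col_mult2[of _ ?N ?N _ ?N])
      (auto simp: assoc_mult_mat_vec[of _ ?N ?N _ ?N] intro!: mult_carrier_mat[of _ ?N ?N])
  moreover have "W\<^sup>H *\<^sub>v (e \<cdot>\<^sub>v col W 0) = e \<cdot>\<^sub>v (W\<^sup>H *\<^sub>v col W 0)"
    using Wu(1) w by (intro mult_mat_vec[of _ ?N ?N]) auto
  moreover have "W\<^sup>H *\<^sub>v col W 0 = col (1\<^sub>m ?N) 0"
    using Wu by (subst col_mult2[symmetric, of _ ?N ?N _ ?N]) auto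
  ultimately have col: "col B 0 = e \<cdot>\<^sub>v unit_vec ?N 0" by simp
  \<comment> \<open>The first basis vector is an eigenvector, which determines the first column of
    \<open>B\<close>. Hermiticity then clears the first row as well and makes \<open>e\<close>
    real.\<close>
  have B0: "B $$ (i, 0) = (if i = 0 then e else 0)" if "i < ?N" for i
    using arg_cong[OF col, of "\<lambda>x. x $ i"] that B by simp
  have B0': "B $$ (0, i) = (if i = 0 then e else 0)" if "i < ?N" for i
  proof -
    have "B $$ (0, i) = B\<^sup>H $$ (0, i)" by (simp add: BH)
    also have "\<dots> = cnj (B $$ (i, 0))" using B that by simp
    finally show ?thesis using B0[OF that] B0[of 0] by (auto split: if_splits)
  qed
  have e: "e = complex_of_real (Re e)"
  proof -
    have "B $$ (0, 0) = B\<^sup>H $$ (0, 0)" by (simp add: BH)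
    also have "\<dots> = cnj (B $$ (0, 0))" using B by simp
    finally show ?thesis using B0[of 0] by (auto simp: complex_eq_iff)
  qed
  define C where "C = mat n n (\<lambda>(i, j). B $$ (Suc i, Suc j))"
  have C: "C \<in> carrier_mat n n" by (simp add: C_def)
  have "C\<^sup>H = C"
  proof (rule eq_matI)
    fix i j assume "i < dim_row C" "j < dim_col C"
    then have ij: "i < n" "j < n" using C by auto
    have "C\<^sup>H $$ (i, j) = cnj (B $$ (Suc j, Suc i))" using ij C by (subst adjoint_index) (auto simp: C_def)
    also have "\<dots> = B\<^sup>H $$ (Suc i, Suc j)" using ij B by simp
    finally show "C\<^sup>H $$ (i, j) = C $$ (i, j)" using ij BH by (simp add: C_def)
  qed (use C in auto)
  from Suc.IH[OF C this] obtain V l where V: "V \<in> unitary_ops n" and Cl: "C = V * real_diag n l * V\<^sup>H"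
    by blast
  note Vu = unitary_opsD[OF V]
  define fb where "fb X Y = four_block_mat X (0\<^sub>m 1 n) (0\<^sub>m n 1) Y" for X Y :: "complex mat"
  \<comment> \<open>The new eigenvalue comes first, so the spectrum of \<open>C\<close> is shifted
    by one.\<close>
  define k where "k i = (case i of 0 \<Rightarrow> Re e | Suc j \<Rightarrow> l j)" for i
  define U where "U = fb (1\<^sub>m 1) V"
  have kD: "real_diag ?N k = fb (real_diag 1 (\<lambda>_. Re e)) (real_diag n l)"
    by (rule eq_matI) (auto simp: fb_def k_def split: nat.splits)
  have Bfb: "B = fb (real_diag 1 (\<lambda>_. Re e)) C"
  proof (rule eq_matI)
    fix i j assume "i < dim_row (fb (real_diag 1 (\<lambda>_. Re e)) C)" "j < dim_col (fb (real_diag 1 (\<lambda>_. Re e)) C)"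
    then have "i < ?N" "j < ?N" using C by (auto simp: fb_def)
    then show "B $$ (i, j) = fb (real_diag 1 (\<lambda>_. Re e)) C $$ (i, j)"
      using B0[of i] B0'[of j] C e by (cases i; cases j) (auto simp: fb_def C_def)
  qed (use B C in \<open>auto simp: fb_def\<close>)
  have UH: "U\<^sup>H = fb (1\<^sub>m 1) (V\<^sup>H)" using Vu(1) by (simp add: U_def fb_def adjoint_four_block_diag)
  have fbm: "fb X Y * fb X' Y' = fb (X * X') (Y * Y')"
    if "X \<in> carrier_mat 1 1" "X' \<in> carrier_mat 1 1" "Y \<in> carrier_mat n n" "Y' \<in> carrier_mat n n"
    for X Y X' Y' unfolding fb_def using that by (intro mult_four_block_diag) auto
  have Uc: "U \<in> carrier_mat ?N ?N" unfolding U_def fb_def using Vu(1) four_block_carrier_mat[of "1\<^sub>m 1" 1 1 V n n] by simp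
  have "U\<^sup>H * U = fb (1\<^sub>m 1) (1\<^sub>m n)"
    unfolding UH unfolding U_def using Vu by (subst fbm) auto
  also have "\<dots> = 1\<^sub>m ?N" by (simp add: fb_def four_block_one_mat)
  finally have U: "U \<in> unitary_ops ?N" using Uc by (intro unitary_opsI)
  have "B = U * real_diag ?N k * U\<^sup>H"
    unfolding UH kD Bfb unfolding U_def Cl using Vu
    by (simp add: fbm mult_carrier_mat[of _ n n _ n] left_mult_one_mat[of _ 1 1] right_mult_one_mat[of _ 1 1])
  then have "A = W * (U * real_diag ?N k * U\<^sup>H) * W\<^sup>H" using AWBW by simp
  also have "\<dots> = (W * U) * real_diag ?N k * (W * U)\<^sup>H"
    using Wu(1) Uc by (simp add: adjoint_mult[of _ ?N ?N _ ?N] assoc_mult_mat[of _ ?N ?N _ ?N _ ?N]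
        mult_carrier_mat[of _ ?N ?N _ ?N])
  finally show ?case using unitary_ops_mult[OF W U] by blast
qed

subsection \<open>Positive operators and their square roots\<close>

lemma adjoint_smult:
  fixes A :: "complex mat"
  shows "(c \<cdot>\<^sub>m A)\<^sup>H = cnj c \<cdot>\<^sub>m A\<^sup>H"
  by (rule eq_matI) auto

text \<open>Keeping the eigenbasis \<open>V\<close> apart from the spectrum \<open>l\<close> turns
  products, roots and pseudo-inverses into pointwise arithmetic on \<open>l\<close>. Only the values
  of \<open>l\<close> below \<open>n\<close> matter.\<close>

definition spectral_mat :: "nat \<Rightarrow> complex mat \<Rightarrow> (nat \<Rightarrow> real) \<Rightarrow> complex mat" where
  "spectral_mat n V l = V * real_diag n l * V\<^sup>H"

lemma spectral_mat_cong: "(\<And>i. i < n \<Longrightarrow> l i = k i) \<Longrightarrow> spectral_mat n V l = spectral_mat n V k"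
proof -
  assume "\<And>i. i < n \<Longrightarrow> l i = k i"
  then have "real_diag n l = real_diag n k" by (intro eq_matI) auto
  then show ?thesis by (simp add: spectral_mat_def)
qed

section \<open>Functional calculus in a fixed eigenbasis\<close>

context
  fixes n :: nat and V :: "complex mat"
  assumes V: "V \<in> unitary_ops n"
begin

lemma spectral_mat_carrier [simp]: "spectral_mat n V l \<in> carrier_mat n n"
  unfolding spectral_mat_def using unitary_opsD(1)[OF V]
  by (intro mult_carrier_mat[of _ n n] adjoint_carrier) auto

lemma adjoint_spectral_mat: "(spectral_mat n V l)\<^sup>H = spectral_mat n V l"
  using unitary_opsD(1)[OF V]
  by (simp add: spectral_mat_def adjoint_mult[of _ n n _ n] assoc_mult_mat[of _ n n _ n _ n]
      mult_carrier_mat[of _ n n _ n])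

lemma spectral_mat_mult: "spectral_mat n V l * spectral_mat n V k = spectral_mat n V (\<lambda>i. l i * k i)"
proof -
  note [simp] = unitary_opsD(1)[OF V]
  have "V\<^sup>H * (V * X) = X" if "X \<in> carrier_mat n n" for X
    using that unitary_opsD(2)[OF V] by (subst assoc_mult_mat[symmetric, of _ n n _ n _ n]) auto
  moreover have "real_diag n l * (real_diag n k * X) = real_diag n (\<lambda>i. l i * k i) * X"
    if "X \<in> carrier_mat n n" for X
    using that by (subst assoc_mult_mat[symmetric, of _ n n _ n _ n]) (auto simp: real_diag_mult)
  ultimately show ?thesis
    by (simp add: spectral_mat_def assoc_mult_mat[of _ n n _ n _ n] mult_carrier_mat[of _ n n _ n])
qed

lemma spectral_mat_one: "spectral_mat n V (\<lambda>_. 1) = 1\<^sub>m n"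
  using unitary_opsD[OF V] by (simp add: spectral_mat_def real_diag_one right_mult_one_mat[of _ n n])

lemma spectral_mat_zero: "spectral_mat n V (\<lambda>_. 0) = 0\<^sub>m n n"
proof -
  have "real_diag n (\<lambda>_. 0) = 0\<^sub>m n n" by (rule eq_matI) auto
  then show ?thesis using unitary_opsD(1)[OF V]
    by (simp add: spectral_mat_def right_mult_zero_mat[of _ n n] left_mult_zero_mat[of _ n n])
qed

lemma mat_trace_spectral_mat: "mat_trace (spectral_mat n V l) = complex_of_real (\<Sum>i<n. l i)"
proof -
  note [simp] = unitary_opsD[OF V]
  have "mat_trace (spectral_mat n V l) = mat_trace (V\<^sup>H * (V * real_diag n l))"
    unfolding spectral_mat_def by (rule mat_trace_mult_commute[of _ n n]) (auto intro: mult_carrier_mat[of _ n n])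
  also have "V\<^sup>H * (V * real_diag n l) = real_diag n l"
    by (subst assoc_mult_mat[symmetric, of _ n n _ n _ n]) (auto simp: left_mult_one_mat[of _ n n])
  finally show ?thesis by (simp add: mat_trace_sum[of _ n])
qed

text \<open>The entries of \<open>V\<^sup>H *\<^sub>v v\<close> are the coordinates of
  \<open>v\<close> in the eigenbasis, where the operator is diagonal.\<close>

lemma spectral_mat_quadratic:
  assumes v: "v \<in> carrier_vec n"
  shows "(spectral_mat n V l *\<^sub>v v) \<bullet>c v = complex_of_real (\<Sum>i<n. l i * (cmod ((V\<^sup>H *\<^sub>v v) $ i))\<^sup>2)"
proof -
  note [simp] = unitary_opsD[OF V] v
  define w where "w = V\<^sup>H *\<^sub>v v"
  have w: "w \<in> carrier_vec n" unfolding w_def by (rule mult_mat_vec_carrier[of _ n n]) auto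
  have "spectral_mat n V l *\<^sub>v v = V *\<^sub>v (real_diag n l *\<^sub>v w)"
    unfolding spectral_mat_def w_def
    by (simp add: assoc_mult_mat_vec[of _ n n _ n] mult_carrier_mat[of _ n n _ n] mult_mat_vec_carrier[of _ n n])
  then have "(spectral_mat n V l *\<^sub>v v) \<bullet>c v = (real_diag n l *\<^sub>v w) \<bullet>c w"
    unfolding w_def by (simp add: cscalar_prod_adjoint[of V n n] mult_mat_vec_carrier[of _ n n])
  also have "\<dots> = (\<Sum>i<n. complex_of_real (l i) * w $ i * cnj (w $ i))"
  proof -
    have "(real_diag n l *\<^sub>v w) $ i = complex_of_real (l i) * w $ i" if "i < n" for i
    proof -
      have "(real_diag n l *\<^sub>v w) $ i = (\<Sum>a<n. real_diag n l $$ (i, a) * w $ a)"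
        using that w by (subst mult_mat_vec_index_sum[of _ n n]) auto
      also have "\<dots> = (\<Sum>a<n. if a = i then complex_of_real (l i) * w $ i else 0)"
        by (rule sum.cong) (use that in auto)
      finally show ?thesis using that by simp
    qed
    then show ?thesis unfolding cscalar_prod_sum[OF w] by (intro sum.cong) auto
  qed
  also have "\<dots> = complex_of_real (\<Sum>i<n. l i * (cmod (w $ i))\<^sup>2)"
    by (simp add: mult.assoc complex_mult_cnj cmod_power2)
  finally show ?thesis by (simp add: w_def)
qed

lemma spectral_mat_col:
  assumes "i < n"
  shows "spectral_mat n V l *\<^sub>v col V i = complex_of_real (l i) \<cdot>\<^sub>v col V i"
    and "col V i \<bullet>c col V i = 1"
proof -
  note [simp] = unitary_opsD[OF V]
  have c: "col V i \<in> carrier_vec n" using unitary_opsD(1)[OF V] assms by auto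
  have u: "V\<^sup>H *\<^sub>v col V i = unit_vec n i"
    using assms col_mult2[of "V\<^sup>H" n n V n i] by simp
  have "(V\<^sup>H *\<^sub>v col V i) $ i = col V i \<bullet>c col V i"
    using assms c unitary_opsD(1)[OF V]
    by (subst mult_mat_vec_index_sum[of _ n n])
      (auto simp: cscalar_prod_sum[OF c] mult_ac carrier_matD[OF unitary_opsD(1)[OF V]] intro!: sum.cong)
  then show "col V i \<bullet>c col V i = 1" using assms by (simp add: u)
  have "spectral_mat n V l *\<^sub>v col V i = V *\<^sub>v (real_diag n l *\<^sub>v (V\<^sup>H *\<^sub>v col V i))"
    unfolding spectral_mat_def using c
    by (simp add: assoc_mult_mat_vec[of _ n n _ n] mult_carrier_mat[of _ n n _ n] mult_mat_vec_carrier[of _ n n])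
  also have "real_diag n l *\<^sub>v (V\<^sup>H *\<^sub>v col V i) = complex_of_real (l i) \<cdot>\<^sub>v unit_vec n i"
    unfolding u
    by (rule eq_vecI) (use assms in \<open>auto simp: scalar_prod_right_unit[of _ n]\<close>)
  also have "V *\<^sub>v (complex_of_real (l i) \<cdot>\<^sub>v unit_vec n i) = complex_of_real (l i) \<cdot>\<^sub>v (V *\<^sub>v unit_vec n i)"
    by (rule mult_mat_vec[of _ n n]) auto
  also have "V *\<^sub>v unit_vec n i = col V i"
    by (rule eq_vecI)
      (use assms in \<open>auto simp: scalar_prod_right_unit[of _ n] carrier_matD[OF unitary_opsD(1)[OF V]]\<close>)
  finally show "spectral_mat n V l *\<^sub>v col V i = complex_of_real (l i) \<cdot>\<^sub>v col V i" .
qed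

end

lemma hermitian_spectral_mat:
  assumes "A \<in> carrier_mat n n" "A\<^sup>H = A"
  obtains V l where "V \<in> unitary_ops n" "A = spectral_mat n V l"
  using hermitian_diagonalization[OF assms] that unfolding spectral_mat_def by blast

text \<open>Testing real eigenvalues and unit eigenvectors is enough, since the diagonalization
  provides an orthonormal eigenbasis with real spectrum.\<close>

lemma hermitian_eq_0I:
  assumes A: "A \<in> carrier_mat n n" "A\<^sup>H = A"
    and ev: "\<And>v c. v \<in> carrier_vec n \<Longrightarrow> v \<bullet>c v = 1 \<Longrightarrow> A *\<^sub>v v = complex_of_real c \<cdot>\<^sub>v v \<Longrightarrow> c = 0"
  shows "A = 0\<^sub>m n n"
proof -
  obtain V l where V: "V \<in> unitary_ops n" and Al: "A = spectral_mat n V l"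
    using hermitian_spectral_mat[OF A] .
  have "l i = 0" if "i < n" for i
    using spectral_mat_col(1)[OF V that, of l] spectral_mat_col(2)[OF V that] unitary_opsD(1)[OF V] that
    by (intro ev[of "col V i"]) (auto simp: Al)
  then have "A = spectral_mat n V (\<lambda>_. 0)" unfolding Al by (rule spectral_mat_cong)
  then show ?thesis using spectral_mat_zero[OF V] by simp
qed

text \<open>The matrix \<open>\<i> (A - A\<^sup>H)\<close> is Hermitian. Its eigenvalue at a unit
  eigenvector \<open>v\<close> is \<open>\<i>\<close> times the difference of
  \<open>\<langle>A v, v\<rangle>\<close> and its conjugate, which is 0 because positivity makes
  this value real.\<close>

lemma positive_op_hermitian:
  assumes "positive_op n A"
  shows "A\<^sup>H = A"
proof -
  have A: "A \<in> carrier_mat n n" using assms by (simp add: positive_op_def)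
  define H where "H = \<i> \<cdot>\<^sub>m (A - A\<^sup>H)"
  have "H = 0\<^sub>m n n"
  proof (rule hermitian_eq_0I)
    show "H \<in> carrier_mat n n" using A by (simp add: H_def minus_carrier_mat)
    show "H\<^sup>H = H" using A unfolding H_def adjoint_smult
      by (subst adjoint_minus[of _ n n]) (auto intro!: eq_matI simp: algebra_simps)
    fix v c assume v: "v \<in> carrier_vec n" "v \<bullet>c v = 1" and ev: "H *\<^sub>v v = complex_of_real c \<cdot>\<^sub>v v"
    have r: "cnj ((A *\<^sub>v v) \<bullet>c v) = (A *\<^sub>v v) \<bullet>c v"
      using assms v(1) by (auto simp: positive_op_def less_eq_complex_def complex_eq_iff)
    have Av: "A *\<^sub>v v \<in> carrier_vec n" "A\<^sup>H *\<^sub>v v \<in> carrier_vec n"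
      using A v(1) by (auto intro!: mult_mat_vec_carrier[of _ n n])
    have "complex_of_real c = (H *\<^sub>v v) \<bullet>c v"
      using v by (simp add: ev smult_scalar_prod_distrib[of _ n])
    also have "H *\<^sub>v v = \<i> \<cdot>\<^sub>v (A *\<^sub>v v - A\<^sup>H *\<^sub>v v)"
      unfolding H_def using A v(1)
      by (subst minus_mult_distrib_mat_vec[symmetric, of _ n n]) (auto intro!: eq_vecI)
    also have "(\<i> \<cdot>\<^sub>v (A *\<^sub>v v - A\<^sup>H *\<^sub>v v)) \<bullet>c v = \<i> * ((A *\<^sub>v v) \<bullet>c v - (A\<^sup>H *\<^sub>v v) \<bullet>c v)"
      using v(1) Av by (simp add: smult_scalar_prod_distrib[of _ n] minus_scalar_prod_distrib[of _ n])
    also have "(A\<^sup>H *\<^sub>v v) \<bullet>c v = v \<bullet>c (A *\<^sub>v v)"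
      using cscalar_prod_adjoint[of "A\<^sup>H" n n v v] A v(1) by simp
    also have "v \<bullet>c (A *\<^sub>v v) = (A *\<^sub>v v) \<bullet>c v"
      using cscalar_prod_commute[of "A *\<^sub>v v" n v] Av v(1) r by simp
    finally show "c = 0" by simp
  qed
  then have H0: "H $$ (i, j) = 0" if "i < n" "j < n" for i j using that by simp
  have "A\<^sup>H $$ (i, j) = A $$ (i, j)" if "i < n" "j < n" for i j
  proof -
    have "\<i> * (A $$ (i, j) - A\<^sup>H $$ (i, j)) = H $$ (i, j)"
      using that A by (simp add: H_def carrier_matD[OF A])
    then show ?thesis unfolding H0[OF that] by simp
  qed
  then show ?thesis using A by (intro eq_matI) auto
qed

text \<open>Each eigenvalue is the value of the quadratic form at a column of \<open>V\<close>, a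
  unit vector.\<close>

lemma positive_op_spectral_mat:
  assumes "positive_op n A"
  obtains V l where "V \<in> unitary_ops n" "A = spectral_mat n V l" "\<And>i. i < n \<Longrightarrow> 0 \<le> l i"
proof -
  have A: "A \<in> carrier_mat n n" using assms by (simp add: positive_op_def)
  obtain V l where V: "V \<in> unitary_ops n" and Al: "A = spectral_mat n V l"
    using hermitian_spectral_mat[OF A positive_op_hermitian[OF assms]] .
  have "0 \<le> l i" if i: "i < n" for i
  proof -
    have c: "col V i \<in> carrier_vec n" using unitary_opsD(1)[OF V] i by auto
    then have "0 \<le> (A *\<^sub>v col V i) \<bullet>c col V i" using assms by (simp add: positive_op_def)
    also have "\<dots> = complex_of_real (l i)"
      using spectral_mat_col[OF V i] c by (simp add: Al smult_scalar_prod_distrib[of _ n])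
    finally show ?thesis by (simp add: less_eq_complex_def)
  qed
  with V Al show ?thesis using that by blast
qed

lemma spectral_mat_positive:
  assumes "V \<in> unitary_ops n" "\<And>i. i < n \<Longrightarrow> 0 \<le> l i"
  shows "positive_op n (spectral_mat n V l)"
  unfolding positive_op_def
proof (intro conjI ballI)
  show "spectral_mat n V l \<in> carrier_mat n n" using assms(1) by simp
  fix v :: "complex vec" assume "v \<in> carrier_vec n"
  then have "(spectral_mat n V l *\<^sub>v v) \<bullet>c v = complex_of_real (\<Sum>i<n. l i * (cmod ((V\<^sup>H *\<^sub>v v) $ i))\<^sup>2)"
    by (rule spectral_mat_quadratic[OF assms(1)])
  moreover have "0 \<le> (\<Sum>i<n. l i * (cmod ((V\<^sup>H *\<^sub>v v) $ i))\<^sup>2)"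
    using assms(2) by (intro sum_nonneg mult_nonneg_nonneg) auto
  ultimately show "0 \<le> (spectral_mat n V l *\<^sub>v v) \<bullet>c v"
    by (simp only: less_eq_complex_def Re_complex_of_real Im_complex_of_real zero_complex.simps)
qed

lemma adjoint_mult_self_quadratic:
  fixes L :: "complex mat"
  assumes "L \<in> carrier_mat m n" "v \<in> carrier_vec n"
  shows "((L\<^sup>H * L) *\<^sub>v v) \<bullet>c v = (L *\<^sub>v v) \<bullet>c (L *\<^sub>v v)"
proof -
  have Lv: "L *\<^sub>v v \<in> carrier_vec m" using assms by (intro mult_mat_vec_carrier)
  have "(L\<^sup>H * L) *\<^sub>v v = L\<^sup>H *\<^sub>v (L *\<^sub>v v)"
    using assms by (intro assoc_mult_mat_vec[of _ n m _ n]) auto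
  then show ?thesis using cscalar_prod_adjoint[of "L\<^sup>H" n m "L *\<^sub>v v" v] assms Lv by simp
qed

lemma positive_op_adjoint_mult_self:
  fixes L :: "complex mat"
  assumes "L \<in> carrier_mat m n"
  shows "positive_op n (L\<^sup>H * L)"
  unfolding positive_op_def
proof (intro conjI ballI)
  show "L\<^sup>H * L \<in> carrier_mat n n" using assms by (intro mult_carrier_mat[of _ n m]) auto
  fix v :: "complex vec" assume "v \<in> carrier_vec n"
  then show "0 \<le> ((L\<^sup>H * L) *\<^sub>v v) \<bullet>c v"
    using assms conjugate_square_ge_0_vec[of "L *\<^sub>v v"]
    by (simp add: adjoint_mult_self_quadratic)
qed

text \<open>If \<open>D = P - R\<close> has the eigenvector \<open>v\<close> for \<open>c\<close>, then \<open>P\<^sup>2 - R\<^sup>2 = D P + R D\<close> gives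
  \<open>0 = c (\<langle>P v, v\<rangle> + \<langle>R v, v\<rangle>)\<close>, while \<open>c = \<langle>P v, v\<rangle> - \<langle>R v, v\<rangle>\<close>; both brackets are nonnegative.\<close>

lemma positive_sqrt_unique:
  assumes P: "positive_op n P" and R: "positive_op n R" and eq: "P * P = R * R"
  shows "P = R"
proof -
  have Pc: "P \<in> carrier_mat n n" and Rc: "R \<in> carrier_mat n n" using P R by (auto simp: positive_op_def)
  note PH = positive_op_hermitian[OF P] and RH = positive_op_hermitian[OF R]
  define D where "D = P - R"
  have D: "D \<in> carrier_mat n n" using Pc Rc by (simp add: D_def minus_carrier_mat)
  have DH: "D\<^sup>H = D" using Pc Rc by (simp add: D_def adjoint_minus[of _ n n] PH RH)
  have "D = 0\<^sub>m n n"
  proof (rule hermitian_eq_0I[OF D DH])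
    fix v c assume v: "v \<in> carrier_vec n" "v \<bullet>c v = 1" and ev: "D *\<^sub>v v = complex_of_real c \<cdot>\<^sub>v v"
    define p r where "p = P *\<^sub>v v" and "r = R *\<^sub>v v"
    have pr: "p \<in> carrier_vec n" "r \<in> carrier_vec n"
      using Pc Rc v(1) by (auto simp: p_def r_def intro!: mult_mat_vec_carrier[of _ n n])
    have pp: "p \<bullet>c p = ((P * P) *\<^sub>v v) \<bullet>c v"
      using adjoint_mult_self_quadratic[OF Pc v(1)] by (simp add: PH p_def)
    have rr: "r \<bullet>c r = ((R * R) *\<^sub>v v) \<bullet>c v"
      using adjoint_mult_self_quadratic[OF Rc v(1)] by (simp add: RH r_def)
    have "p - r = D *\<^sub>v v" unfolding p_def r_def D_def
      using Pc Rc v(1) by (subst minus_mult_distrib_mat_vec[of _ n n]) auto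
    then have d: "p - r = complex_of_real c \<cdot>\<^sub>v v" using ev by simp
    have d': "p $ i = r $ i + complex_of_real c * v $ i" if "i < n" for i
      using arg_cong[OF d, of "\<lambda>x. x $ i"] that pr v(1) by (simp add: algebra_simps)
    have "p \<bullet>c p - r \<bullet>c r = (\<Sum>i<n. p $ i * cnj (p $ i) - r $ i * cnj (r $ i))"
      using pr by (simp add: cscalar_prod_sum[of _ n] sum_subtractf)
    also have "\<dots> = (\<Sum>i<n. complex_of_real c * (v $ i * cnj (p $ i) + r $ i * cnj (v $ i)))"
      by (rule sum.cong) (simp_all add: d' algebra_simps)
    also have "\<dots> = complex_of_real c * (v \<bullet>c p + r \<bullet>c v)"
      using pr v(1) by (simp only: cscalar_prod_sum[of _ n] flip: sum_distrib_left sum.distrib)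
    finally have "p \<bullet>c p - r \<bullet>c r = complex_of_real c * (v \<bullet>c p + r \<bullet>c v)" .
    moreover have "p \<bullet>c p - r \<bullet>c r = 0" by (simp add: pp rr eq)
    moreover have "v \<bullet>c p = cnj (p \<bullet>c v)" using cscalar_prod_commute[of p n v] pr v by simp
    ultimately have 1: "c = 0 \<or> cnj (p \<bullet>c v) + r \<bullet>c v = 0" by simp
    have 2: "complex_of_real c = p \<bullet>c v - r \<bullet>c v"
    proof -
      have "p \<bullet>c v = (\<Sum>i<n. r $ i * cnj (v $ i) + complex_of_real c * (v $ i * cnj (v $ i)))"
        unfolding cscalar_prod_sum[OF v(1)] by (rule sum.cong) (simp_all add: d' algebra_simps)
      then have "p \<bullet>c v = r \<bullet>c v + complex_of_real c * (v \<bullet>c v)"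
        by (simp only: cscalar_prod_sum[OF v(1)] sum.distrib flip: sum_distrib_left)
      then show ?thesis using v by simp
    qed
    have "0 \<le> p \<bullet>c v" "0 \<le> r \<bullet>c v" using P R v(1) by (auto simp: positive_op_def p_def r_def)
    then show "c = 0" using 1 2 by (auto simp: less_eq_complex_def complex_eq_iff)
  qed
  then have "D $$ (i, j) = 0" if "i < n" "j < n" for i j using that by simp
  then show ?thesis using Pc Rc by (intro eq_matI) (auto simp: D_def)
qed

section \<open>Square roots and absolute values\<close>

lemma mat_sqrt_eqI:
  assumes "positive_op n P" "P * P = A"
  shows "mat_sqrt A = P"
proof -
  have "dim_row A = n" using assms by (auto simp: positive_op_def)
  show ?thesis unfolding mat_sqrt_def \<open>dim_row A = n\<close>
  proof (rule the_equality)
    fix R assume "positive_op n R \<and> R * R = A"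
    then show "R = P" using assms positive_sqrt_unique[of n R P] by simp
  qed (use assms in simp)
qed

text \<open>A common eigenbasis for \<open>|L|\<close> and \<open>L\<^sup>H L\<close> makes the
  trace norm the sum of the \<open>l i\<close> and links it to the norms of the images of the basis
  vectors under \<open>L\<close>.\<close>

lemma mat_abs_spectral_mat:
  assumes L: "L \<in> carrier_mat n n"
  obtains V l where "V \<in> unitary_ops n" "\<And>i. 0 \<le> l i"
    "mat_abs L = spectral_mat n V l" "L\<^sup>H * L = spectral_mat n V (\<lambda>i. l i * l i)"
proof -
  obtain V m where V: "V \<in> unitary_ops n" and m: "L\<^sup>H * L = spectral_mat n V m" "\<And>i. i < n \<Longrightarrow> 0 \<le> m i"
    using positive_op_spectral_mat[OF positive_op_adjoint_mult_self[OF L]] by blast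
  \<comment> \<open>The absolute value keeps \<open>l\<close> nonnegative at indices beyond
    \<open>n\<close> too, where the sign of \<open>m\<close> is unknown, so that
    \<open>0 \<le> l i\<close> holds without a bound on \<open>i\<close>.\<close>
  define l where "l i = sqrt \<bar>m i\<bar>" for i
  have ll: "L\<^sup>H * L = spectral_mat n V (\<lambda>i. l i * l i)"
    unfolding m(1) by (rule spectral_mat_cong) (use m(2) in \<open>auto simp: l_def\<close>)
  have "mat_abs L = spectral_mat n V l"
    unfolding mat_abs_def ll
    by (rule mat_sqrt_eqI) (auto intro!: spectral_mat_positive simp: V spectral_mat_mult l_def)
  with V ll show ?thesis using that[of V l] by (simp add: l_def)
qed

lemma positive_op_mat_abs:
  assumes "L \<in> carrier_mat n n"
  shows "positive_op n (mat_abs L)"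
  using mat_abs_spectral_mat[OF assms] spectral_mat_positive by metis

lemma mat_abs_square:
  assumes "L \<in> carrier_mat n n"
  shows "mat_abs L * mat_abs L = L\<^sup>H * L"
  using mat_abs_spectral_mat[OF assms] spectral_mat_mult by metis

text \<open>The trace is the sum of the eigenvalues, all of which are nonnegative.\<close>

lemma positive_op_trace_eq_0D:
  assumes "positive_op n A" "mat_trace A = 0"
  shows "A = 0\<^sub>m n n"
proof -
  obtain V l where V: "V \<in> unitary_ops n" "A = spectral_mat n V l" and l: "\<And>i. i < n \<Longrightarrow> 0 \<le> l i"
    using positive_op_spectral_mat[OF assms(1)] by blast
  have "(\<Sum>i<n. l i) = 0"
    using assms(2) by (simp only: V(2) mat_trace_spectral_mat[OF V(1)] of_real_eq_0_iff)
  then have "l i = 0" if "i < n" for i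
    using l that sum_nonneg_eq_0_iff[of "{..<n}" l] by auto
  then have "A = spectral_mat n V (\<lambda>_. 0)" unfolding V(2) by (rule spectral_mat_cong)
  then show ?thesis using spectral_mat_zero[OF V(1)] by simp
qed

subsection \<open>Trace norm duality\<close>

text \<open>Operator norm at most 1, phrased through vectors so that the condition passes directly
  to entrywise limits.\<close>

definition contraction :: "nat \<Rightarrow> complex mat \<Rightarrow> bool" where
  "contraction n Q \<longleftrightarrow> Q \<in> carrier_mat n n \<and>
     (\<forall>v\<in>carrier_vec n. Re ((Q *\<^sub>v v) \<bullet>c (Q *\<^sub>v v)) \<le> Re (v \<bullet>c v))"

lemma contractionD:
  assumes "contraction n Q"
  shows "Q \<in> carrier_mat n n"
    "v \<in> carrier_vec n \<Longrightarrow> Re ((Q *\<^sub>v v) \<bullet>c (Q *\<^sub>v v)) \<le> Re (v \<bullet>c v)"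
  using assms by (auto simp: contraction_def)

lemma contraction_of_adjoint_mult_self:
  assumes Q: "Q \<in> carrier_mat n n" and V: "V \<in> unitary_ops n"
    and QQ: "Q\<^sup>H * Q = spectral_mat n V l" and l: "\<And>i. i < n \<Longrightarrow> l i \<le> 1"
  shows "contraction n Q"
  unfolding contraction_def
proof (intro conjI ballI Q)
  fix v :: "complex vec" assume v: "v \<in> carrier_vec n"
  have "(Q *\<^sub>v v) \<bullet>c (Q *\<^sub>v v) = (spectral_mat n V l *\<^sub>v v) \<bullet>c v"
    using adjoint_mult_self_quadratic[OF Q v] QQ by simp
  also have "Re \<dots> = (\<Sum>i<n. l i * (cmod ((V\<^sup>H *\<^sub>v v) $ i))\<^sup>2)"
    by (simp only: spectral_mat_quadratic[OF V v] Re_complex_of_real)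
  also have "\<dots> \<le> (\<Sum>i<n. 1 * (cmod ((V\<^sup>H *\<^sub>v v) $ i))\<^sup>2)"
    by (intro sum_mono mult_right_mono l) auto
  also have "\<dots> = Re ((spectral_mat n V (\<lambda>_. 1) *\<^sub>v v) \<bullet>c v)"
    by (simp only: spectral_mat_quadratic[OF V v] Re_complex_of_real)
  also have "\<dots> = Re (v \<bullet>c v)" using v by (simp add: spectral_mat_one[OF V])
  finally show "Re ((Q *\<^sub>v v) \<bullet>c (Q *\<^sub>v v)) \<le> Re (v \<bullet>c v)" .
qed

lemma unitary_contraction:
  assumes "U \<in> unitary_ops n"
  shows "contraction n U"
  using contraction_of_adjoint_mult_self[of U n U "\<lambda>_. 1"] assms unitary_opsD[OF assms]
  by (simp add: spectral_mat_one)

text \<open>One half of the duality. With the trace taken over the eigenbasis of \<open>|X|\<close>,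
  Cauchy-Schwarz bounds the term at the basis vector \<open>v\<close> by the norm of
  \<open>X v\<close>, which is \<open>l i\<close>, times the norm of \<open>Q v\<close>, which is at
  most 1.\<close>

lemma Re_trace_le_trace_norm:
  assumes X: "X \<in> carrier_mat n n" and Q: "contraction n Q"
  shows "Re (mat_trace (Q\<^sup>H * X)) \<le> trace_norm X"
proof -
  obtain V l where V: "V \<in> unitary_ops n" and l: "\<And>i. 0 \<le> l i"
    and abs: "mat_abs X = spectral_mat n V l" and XX: "X\<^sup>H * X = spectral_mat n V (\<lambda>i. l i * l i)"
    using mat_abs_spectral_mat[OF X] by metis
  note Vu = unitary_opsD[OF V] and Qc = contractionD(1)[OF Q]
  note [simp] = Vu(1) Qc X
  have "mat_trace ((Q * V)\<^sup>H * (X * V)) = mat_trace (V\<^sup>H * (Q\<^sup>H * X * V))"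
    by (simp add: adjoint_mult[of _ n n _ n] assoc_mult_mat[of _ n n _ n _ n] mult_carrier_mat[of _ n n _ n])
  also have "\<dots> = mat_trace (Q\<^sup>H * X * V * V\<^sup>H)"
    by (rule mat_trace_mult_commute[of _ n n]) (auto intro!: mult_carrier_mat[of _ n n])
  also have "Q\<^sup>H * X * V * V\<^sup>H = Q\<^sup>H * X"
    using Vu(3) by (simp add: assoc_mult_mat[of _ n n _ n _ n] mult_carrier_mat[of _ n n _ n] right_mult_one_mat[of _ n n])
  finally have "mat_trace (Q\<^sup>H * X) = (\<Sum>i<n. col (X * V) i \<bullet>c col (Q * V) i)"
    by (subst (asm) mat_trace_adjoint_mult[of _ n n]) (auto intro!: mult_carrier_mat[of _ n n])
  then have "Re (mat_trace (Q\<^sup>H * X)) = (\<Sum>i<n. Re (col (X * V) i \<bullet>c col (Q * V) i))" by simp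
  also have "\<dots> \<le> (\<Sum>i<n. l i)"
  proof (rule sum_mono)
    fix i assume "i \<in> {..<n}"
    then have i: "i < n" by simp
    let ?v = "col V i"
    have v: "?v \<in> carrier_vec n" using i Vu(1) by (metis col_carrier_vec)
    have c: "col (X * V) i = X *\<^sub>v ?v" "col (Q * V) i = Q *\<^sub>v ?v"
      using i by (auto intro!: col_mult2[of _ n n _ n])
    have "(X *\<^sub>v ?v) \<bullet>c (X *\<^sub>v ?v) = (spectral_mat n V (\<lambda>i. l i * l i) *\<^sub>v ?v) \<bullet>c ?v"
      using adjoint_mult_self_quadratic[OF X v] XX by simp
    also have "\<dots> = complex_of_real (l i * l i)"
      using spectral_mat_col[OF V i] v by (simp add: smult_scalar_prod_distrib[of _ n])
    finally have "sqrt (Re ((X *\<^sub>v ?v) \<bullet>c (X *\<^sub>v ?v))) = l i" using l[of i] by simp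
    moreover have "sqrt (Re ((Q *\<^sub>v ?v) \<bullet>c (Q *\<^sub>v ?v))) \<le> 1"
      using contractionD(2)[OF Q v] spectral_mat_col(2)[OF V i] by simp
    moreover have "Re ((X *\<^sub>v ?v) \<bullet>c (Q *\<^sub>v ?v)) \<le>
        sqrt (Re ((X *\<^sub>v ?v) \<bullet>c (X *\<^sub>v ?v))) * sqrt (Re ((Q *\<^sub>v ?v) \<bullet>c (Q *\<^sub>v ?v)))"
      using v by (intro Cauchy_Schwarz_cscalar_prod[of _ n] mult_mat_vec_carrier[of _ n n]) auto
    ultimately show "Re (col (X * V) i \<bullet>c col (Q * V) i) \<le> l i"
      using mult_left_mono[of "sqrt (Re ((Q *\<^sub>v ?v) \<bullet>c (Q *\<^sub>v ?v)))" 1 "l i"] l[of i] by (simp add: c)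
  qed
  also have "\<dots> = trace_norm X"
    unfolding trace_norm_def abs by (simp only: mat_trace_spectral_mat[OF V] Re_complex_of_real)
  finally show ?thesis .
qed

text \<open>The other half of the duality: the bound is attained at the partial isometry
  \<open>W\<close> of the polar decomposition. It is a contraction because
  \<open>W\<^sup>H W\<close> has only the eigenvalues 0 and 1.\<close>

lemma mat_abs_eq_contraction_mult:
  assumes L: "L \<in> carrier_mat n n"
  obtains W where "contraction n W" "mat_abs L = W\<^sup>H * L"
proof -
  obtain V l where V: "V \<in> unitary_ops n" and l: "\<And>i. 0 \<le> l i"
    and abs: "mat_abs L = spectral_mat n V l" and LL: "L\<^sup>H * L = spectral_mat n V (\<lambda>i. l i * l i)"
    using mat_abs_spectral_mat[OF L] by metis
  \<comment> \<open>\<open>r\<close> is the pseudo-inverse spectrum: \<open>1 / 0 = 0\<close> makes \<open>W\<close> the partial isometry of \<open>L\<close>.\<close>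
  define r where "r i = 1 / l i" for i
  define W where "W = L * spectral_mat n V r"
  have Vr: "spectral_mat n V r \<in> carrier_mat n n" by (rule spectral_mat_carrier[OF V])
  have W: "W \<in> carrier_mat n n" unfolding W_def using L Vr by (rule mult_carrier_mat)
  have WH: "W\<^sup>H = spectral_mat n V r * L\<^sup>H"
    unfolding W_def by (simp add: adjoint_mult[OF L Vr] adjoint_spectral_mat[OF V])
  have WL: "W\<^sup>H * L = spectral_mat n V (\<lambda>i. r i * (l i * l i))"
    unfolding WH using L Vr
    by (simp add: assoc_mult_mat[of _ n n _ n _ n] LL spectral_mat_mult[OF V])
  have "W\<^sup>H * L = mat_abs L"
    unfolding WL abs by (rule spectral_mat_cong) (simp add: r_def)
  moreover have "W\<^sup>H * W = W\<^sup>H * L * spectral_mat n V r"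
    unfolding W_def using W L Vr by (simp add: W_def[symmetric] assoc_mult_mat[of _ n n _ n _ n])
  then have "W\<^sup>H * W = spectral_mat n V (\<lambda>i. r i * (l i * l i) * r i)"
    unfolding WL by (simp add: spectral_mat_mult[OF V])
  then have "contraction n W"
    by (rule contraction_of_adjoint_mult_self[OF W V]) (simp add: r_def)
  ultimately show ?thesis using that by metis
qed

text \<open>An orthogonal projection equals \<open>X\<^sup>H X\<close>, hence is positive and its
  own square root.\<close>

lemma mat_abs_projection:
  assumes "X \<in> carrier_mat n n" "X\<^sup>H = X" "X * X = X"
  shows "mat_abs X = X"
proof -
  have "positive_op n X" using positive_op_adjoint_mult_self[OF assms(1)] assms by simp
  then show ?thesis unfolding mat_abs_def by (rule mat_sqrt_eqI) (simp add: assms(2))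
qed

text \<open>Expanding the square and using \<open>|L| |L| = L\<^sup>H L\<close> leaves
  \<open>|L|\<close> only in the trace norm, which is where the duality enters.\<close>

lemma unitarity_defect_eq:
  assumes L: "L \<in> carrier_mat d d"
  shows "unitarity_defect d L = (Re (mat_trace (L\<^sup>H * L)) - 2 * trace_norm L + real d) / real d"
proof -
  define H where "H = mat_abs L"
  have H: "H \<in> carrier_mat d d" using positive_op_mat_abs[OF L] by (simp add: H_def positive_op_def)
  have HH: "H * H = L\<^sup>H * L" using mat_abs_square[OF L] by (simp add: H_def)
  have c: "H * H \<in> carrier_mat d d" using H by simp
  have "(H - 1\<^sub>m d) ^\<^sub>m 2 = (H - 1\<^sub>m d) * (H - 1\<^sub>m d)"
    using H by (simp add: numeral_2_eq_2 left_mult_one_mat[of _ d d] minus_carrier_mat)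
  also have "\<dots> = (H * H - H) - (H - 1\<^sub>m d)"
    using H by (simp add: minus_mult_distrib_mat[of _ d d] mult_minus_distrib_mat[of _ d d] minus_carrier_mat
        left_mult_one_mat[of _ d d] right_mult_one_mat[of _ d d])
  finally have "mat_trace ((H - 1\<^sub>m d) ^\<^sub>m 2) = mat_trace (H * H) - mat_trace H - (mat_trace H - of_nat d)"
    using H c by (simp add: mat_trace_diff[of _ d] minus_carrier_mat)
  then show ?thesis
    by (simp add: unitarity_defect_def trace_norm_def HH H_def[symmetric])
qed

subsection \<open>The projection onto the range of a matrix\<close>

text \<open>The projection is \<open>M * M\<^sup>H\<close> times its pseudo-inverse. The
  factorization \<open>P = M * B\<close> puts its range into the column space of \<open>M\<close>,
  and \<open>P * M = M\<close> gives the converse inclusion.\<close>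

lemma range_projection:
  fixes M :: "complex mat"
  assumes M: "M \<in> carrier_mat N m"
  obtains P B where "P \<in> carrier_mat N N" "P\<^sup>H = P" "P * P = P" "P * M = M"
    "B \<in> carrier_mat m N" "P = M * B"
proof -
  have MH: "M\<^sup>H \<in> carrier_mat m N" using M by simp
  obtain V l where V: "V \<in> unitary_ops N" and MM: "M * M\<^sup>H = spectral_mat N V l"
    using positive_op_spectral_mat[OF positive_op_adjoint_mult_self[OF MH], unfolded adjoint_adjoint] by blast
  \<comment> \<open>Since \<open>1 / 0 = 0\<close>, the eigenvalues of \<open>P\<close> are 0 and 1,
    and the second factor of \<open>B\<close> is the pseudo-inverse of
    \<open>M * M\<^sup>H\<close>.\<close>
  define P where "P = spectral_mat N V (\<lambda>i. l i * (1 / l i))"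
  define B where "B = M\<^sup>H * spectral_mat N V (\<lambda>i. 1 / l i)"
  have P: "P \<in> carrier_mat N N" "P\<^sup>H = P"
    by (simp_all add: P_def V spectral_mat_carrier adjoint_spectral_mat)
  have PP: "P * P = P"
    unfolding P_def spectral_mat_mult[OF V] by (rule spectral_mat_cong) auto
  have c: "spectral_mat N V k \<in> carrier_mat N N" for k by (rule spectral_mat_carrier[OF V])
  have B: "B \<in> carrier_mat m N" unfolding B_def using MH c by (rule mult_carrier_mat)
  have PB: "P = M * B"
    unfolding B_def P_def using M MH c
    by (subst assoc_mult_mat[symmetric, of _ N m _ N _ N]) (auto simp: MM spectral_mat_mult[OF V])
  \<comment> \<open>\<open>R\<close> annihilates \<open>M * M\<^sup>H\<close>, so the product of
    \<open>R * M\<close> with its adjoint is 0. Then \<open>R * M = 0\<close>, which is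
    \<open>P * M = M\<close>.\<close>
  define R where "R = 1\<^sub>m N - P"
  have R: "R \<in> carrier_mat N N" "R\<^sup>H = R"
    using P by (auto simp: R_def adjoint_minus[of _ N N] minus_carrier_mat)
  have RM: "R * M \<in> carrier_mat N m" using R M by simp
  have "P * (M * M\<^sup>H) = M * M\<^sup>H"
    unfolding MM P_def spectral_mat_mult[OF V] by (rule spectral_mat_cong) auto
  moreover have "M * M\<^sup>H \<in> carrier_mat N N" using M MH by (rule mult_carrier_mat)
  ultimately have "R * (M * M\<^sup>H) = 0\<^sub>m N N"
    unfolding R_def using P
    by (simp add: minus_mult_distrib_mat[of _ N N _ _ N] left_mult_one_mat[of _ N N] minus_r_inv_mat[of _ N N])
  moreover have "(R * M) * (R * M)\<^sup>H = R * (M * M\<^sup>H) * R"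
    using R M MH by (simp add: adjoint_mult[of _ N N _ m] assoc_mult_mat[of _ N N _ m _ N]
        assoc_mult_mat[of _ N N _ N _ N] assoc_mult_mat[of _ N m _ N _ N] mult_carrier_mat[of _ N m _ N] mult_carrier_mat[of _ m N _ N])
  ultimately have "(R * M) * (R * M)\<^sup>H = 0\<^sub>m N N" using R by (simp add: left_mult_zero_mat[of _ N N])
  then have "R * M = 0\<^sub>m N m" by (rule mult_adjoint_self_eq_0D[OF RM])
  then have RM0: "M - P * M = 0\<^sub>m N m"
    unfolding R_def using P M by (simp add: minus_mult_distrib_mat[of _ N N] left_mult_one_mat[of _ N m])
  have "P * M = M"
  proof (rule eq_matI)
    fix i j assume ij: "i < dim_row M" "j < dim_col M"
    have "(M - P * M) $$ (i, j) = 0" using RM0 ij M by simp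
    then show "(P * M) $$ (i, j) = M $$ (i, j)" using ij M P by (simp del: index_mult_mat(1))
  qed (use M P in auto)
  with P PP B PB show ?thesis using that by blast
qed

subsection \<open>Vectorized operators and the Choi matrix\<close>

lemma pair_index_less:
  fixes i a d :: nat
  assumes "i < d" "a < d"
  shows "i * d + a < d * d"
proof -
  have "i * d + a < Suc i * d" using assms by simp
  also have "\<dots> \<le> d * d" using assms by (intro mult_le_mono1) simp
  finally show ?thesis .
qed

lemma pair_index_bounds:
  fixes r d :: nat
  assumes "r < d * d"
  shows "r div d < d" "r mod d < d"
  using assms by (auto simp: less_mult_imp_div_less intro!: mod_less_divisor) (cases d; simp)

lemma sum_pair_index:
  fixes d :: nat
  shows "(\<Sum>r<d * d. f (r div d) (r mod d)) = (\<Sum>i<d. \<Sum>a<d. f i a)"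
proof -
  have "(\<Sum>r<d * d. f (r div d) (r mod d)) = (\<Sum>(i, a)\<in>{..<d} \<times> {..<d}. f i a)"
    by (rule sum.reindex_bij_witness[of _ "\<lambda>(i, a). i * d + a" "\<lambda>r. (r div d, r mod d)"])
      (auto simp: pair_index_bounds pair_index_less)
  then show ?thesis by (simp add: sum.cartesian_product)
qed

text \<open>Row-major order agrees with the index convention of \<open>ampliation\<close>, so that
  vectorized Kraus operators factor the Choi matrix without any reordering.\<close>

definition vecop :: "nat \<Rightarrow> complex mat \<Rightarrow> complex vec" where
  "vecop d A = vec (d * d) (\<lambda>r. A $$ (r div d, r mod d))"

definition unvec :: "nat \<Rightarrow> complex vec \<Rightarrow> complex mat" where
  "unvec d v = mat d d (\<lambda>(i, a). v $ (i * d + a))"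

lemma vecop_carrier [simp]: "vecop d A \<in> carrier_vec (d * d)" "dim_vec (vecop d A) = d * d"
  by (auto simp: vecop_def)

lemma unvec_carrier [simp]: "unvec d v \<in> carrier_mat d d"
  by (auto simp: unvec_def)

lemma vecop_index [simp]: "r < d * d \<Longrightarrow> vecop d A $ r = A $$ (r div d, r mod d)"
  by (simp add: vecop_def)

lemma vecop_unvec: "v \<in> carrier_vec (d * d) \<Longrightarrow> vecop d (unvec d v) = v"
  by (rule eq_vecI) (auto simp: unvec_def pair_index_bounds)

text \<open>Vectorization is an isometry for the Hilbert-Schmidt inner product, so traces of
  operators become inner products on which a projection can act.\<close>

lemma cscalar_prod_vecop:
  assumes "A \<in> carrier_mat d d" "B \<in> carrier_mat d d"
  shows "vecop d A \<bullet>c vecop d B = mat_trace (B\<^sup>H * A)"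
proof -
  have "vecop d A \<bullet>c vecop d B = (\<Sum>r<d * d. A $$ (r div d, r mod d) * cnj (B $$ (r div d, r mod d)))"
    by (subst cscalar_prod_sum[of _ "d * d"]) (auto intro!: sum.cong)
  also have "\<dots> = (\<Sum>i<d. \<Sum>a<d. A $$ (i, a) * cnj (B $$ (i, a)))"
    by (rule sum_pair_index)
  also have "\<dots> = (\<Sum>a<d. \<Sum>i<d. A $$ (i, a) * cnj (B $$ (i, a)))"
    by (rule sum.swap)
  also have "\<dots> = mat_trace (B\<^sup>H * A)"
    using assms by (subst mat_trace_adjoint_mult[of _ d d]) (auto simp: cscalar_prod_sum[of _ d] intro!: sum.cong)
  finally show ?thesis .
qed

definition munit :: "nat \<Rightarrow> nat \<Rightarrow> nat \<Rightarrow> complex mat" where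
  "munit d a b = mat d d (\<lambda>p. if p = (a, b) then 1 else 0)"

lemma munit_carrier [simp]: "munit d a b \<in> carrier_mat d d"
  by (simp add: munit_def)

lemma sandwich_index:
  fixes E F X :: "complex mat"
  assumes "E \<in> carrier_mat d d" "X \<in> carrier_mat d d" "F \<in> carrier_mat d d" "i < d" "j < d"
  shows "(E * X * F\<^sup>H) $$ (i, j) = (\<Sum>a<d. \<Sum>b<d. X $$ (a, b) * (E $$ (i, a) * cnj (F $$ (j, b))))"
proof -
  have "(E * X * F\<^sup>H) $$ (i, j) = (\<Sum>b<d. (E * X) $$ (i, b) * F\<^sup>H $$ (b, j))"
    using assms by (intro mult_mat_index_sum[of _ d d _ d]) (auto intro: mult_carrier_mat[of _ d d])
  also have "\<dots> = (\<Sum>b<d. \<Sum>a<d. X $$ (a, b) * (E $$ (i, a) * cnj (F $$ (j, b))))"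
    using assms by (intro sum.cong refl) (simp add: mult_mat_index_sum[of E d d X d] sum_distrib_right
        sum_distrib_left mult_ac del: index_mult_mat(1))
  also have "\<dots> = (\<Sum>a<d. \<Sum>b<d. X $$ (a, b) * (E $$ (i, a) * cnj (F $$ (j, b))))"
    by (rule sum.swap)
  finally show ?thesis .
qed

lemma sandwich_munit_index:
  fixes E F :: "complex mat"
  assumes "E \<in> carrier_mat d d" "F \<in> carrier_mat d d" "i < d" "j < d" "a < d" "b < d"
  shows "(E * munit d a b * F\<^sup>H) $$ (i, j) = E $$ (i, a) * cnj (F $$ (j, b))"
proof -
  have "(E * munit d a b * F\<^sup>H) $$ (i, j) =
      (\<Sum>x<d. \<Sum>y<d. munit d a b $$ (x, y) * (E $$ (i, x) * cnj (F $$ (j, y))))"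
    using assms by (intro sandwich_index) auto
  also have "\<dots> = (\<Sum>x<d. \<Sum>y<d. if y = b then if x = a then E $$ (i, a) * cnj (F $$ (j, b)) else 0 else 0)"
    by (intro sum.cong refl) (auto simp: munit_def)
  also have "\<dots> = E $$ (i, a) * cnj (F $$ (j, b))" using assms by simp
  finally show ?thesis .
qed

text \<open>Both claims go through one induction: reading off an entry of
  \<open>f k + finsum (op_space d) f A\<close> requires the dimensions of the shorter sum.\<close>

lemma finsum_op_space:
  assumes "finite A" "\<And>k. k \<in> A \<Longrightarrow> f k \<in> carrier_mat d d"
  shows "finsum (op_space d) f A \<in> carrier_mat d d \<and>
    (\<forall>i<d. \<forall>j<d. finsum (op_space d) f A $$ (i, j) = (\<Sum>k\<in>A. f k $$ (i, j)))"
  using assms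
proof (induction A rule: finite_induct)
  case empty
  interpret abelian_group "op_space d" by (rule abelian_group_mat)
  show ?case by (simp add: module_mat_simps)
next
  case (insert k A)
  interpret abelian_group "op_space d" by (rule abelian_group_mat)
  have "finsum (op_space d) f (insert k A) = f k + finsum (op_space d) f A"
    using insert by (subst finsum_insert) (auto simp: module_mat_simps)
  then show ?case using insert by auto
qed

lemma finsum_op_space_carrier:
  "finite A \<Longrightarrow> (\<And>k. k \<in> A \<Longrightarrow> f k \<in> carrier_mat d d) \<Longrightarrow> finsum (op_space d) f A \<in> carrier_mat d d"
  using finsum_op_space by blast

lemma finsum_op_space_index:
  "finite A \<Longrightarrow> (\<And>k. k \<in> A \<Longrightarrow> f k \<in> carrier_mat d d) \<Longrightarrow> i < d \<Longrightarrow> j < d \<Longrightarrow>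
    finsum (op_space d) f A $$ (i, j) = (\<Sum>k\<in>A. f k $$ (i, j))"
  using finsum_op_space by blast

text \<open>The unnormalized maximally entangled operator \<open>|w><w|\<close> with
  \<open>w = vecop d (1\<^sub>m d)\<close>; its trace is \<open>d\<close>, and the test state is
  obtained by the factor \<open>1 / d\<close>.\<close>

definition max_entangled :: "nat \<Rightarrow> complex mat" where
  "max_entangled d = mat (d * d) (d * d)
     (\<lambda>(r, c). if r div d = r mod d \<and> c div d = c mod d then 1 else 0)"

lemma max_entangled_carrier [simp]: "max_entangled d \<in> carrier_mat (d * d) (d * d)"
  by (simp add: max_entangled_def)

lemma slot_block_max_entangled:
  "a < d \<Longrightarrow> b < d \<Longrightarrow> slot_block d d (max_entangled d) a b = munit d a b"
  by (rule eq_matI) (auto simp: slot_block_def max_entangled_def munit_def pair_index_less)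

text \<open>The factorization through a single row is what shows positivity.\<close>

lemma max_entangled_eq:
  "max_entangled d = (mat 1 (d * d) (\<lambda>(i, r). if r div d = r mod d then 1 else 0))\<^sup>H *
     mat 1 (d * d) (\<lambda>(i, r). if r div d = r mod d then 1 else 0)"
  (is "_ = ?w\<^sup>H * ?w")
proof (rule eq_matI)
  have w: "?w \<in> carrier_mat 1 (d * d)" by simp
  fix r c assume "r < dim_row (?w\<^sup>H * ?w)" "c < dim_col (?w\<^sup>H * ?w)"
  then have rc: "r < d * d" "c < d * d" by auto
  then have "(?w\<^sup>H * ?w) $$ (r, c) = (\<Sum>l<1. ?w\<^sup>H $$ (r, l) * ?w $$ (l, c))"
    using w by (intro mult_mat_index_sum[of _ "d * d" 1 _ "d * d"]) auto
  then show "max_entangled d $$ (r, c) = (?w\<^sup>H * ?w) $$ (r, c)"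
    using rc by (simp add: max_entangled_def del: index_mult_mat(1))
qed (auto simp: max_entangled_def)

text \<open>Defining the Choi matrix as an ampliation makes its positivity an instance of complete
  positivity with \<open>n = d\<close>.\<close>

definition choi :: "nat \<Rightarrow> (complex mat \<Rightarrow> complex mat) \<Rightarrow> complex mat" where
  "choi d T = ampliation d d T (max_entangled d)"

lemma choi_carrier [simp]: "choi d T \<in> carrier_mat (d * d) (d * d)"
  by (simp add: choi_def ampliation_def)

lemma choi_index:
  assumes "r < d * d" "c < d * d"
  shows "choi d T $$ (r, c) = T (munit d (r mod d) (c mod d)) $$ (r div d, c div d)"
  using assms pair_index_bounds[OF assms(1)] pair_index_bounds[OF assms(2)]
  by (simp add: choi_def ampliation_def slot_block_max_entangled)

text \<open>Complete positivity speaks of \<open>n \<ge> 1\<close>, so \<open>n = d\<close> is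
  available only for nonzero \<open>d\<close>; in dimension 0 the quadratic form is an empty
  sum.\<close>

lemma positive_op_choi:
  assumes "completely_positive d \<Phi>"
  shows "positive_op (d * d) (choi d \<Phi>)"
proof (cases "d = 0")
  case True
  then show ?thesis using choi_carrier[of d \<Phi>]
    by (auto simp: positive_op_def scalar_prod_def)
next
  case False
  have "positive_op (d * d) (max_entangled d)"
    unfolding max_entangled_eq by (rule positive_op_adjoint_mult_self[of _ 1]) simp
  then show ?thesis using assms False by (simp add: completely_positive_def choi_def)
qed

subsection \<open>Kraus representations\<close>

lemma module_hom_op_spaceD:
  assumes "\<Phi> \<in> LinearCombinations.module_hom class_ring (op_space d) (op_space d)"
  shows "X \<in> carrier_mat d d \<Longrightarrow> \<Phi> X \<in> carrier_mat d d"
    "X \<in> carrier_mat d d \<Longrightarrow> Y \<in> carrier_mat d d \<Longrightarrow> \<Phi> (X + Y) = \<Phi> X + \<Phi> Y"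
    "X \<in> carrier_mat d d \<Longrightarrow> \<Phi> (c \<cdot>\<^sub>m X) = c \<cdot>\<^sub>m \<Phi> X"
  using assms by (auto simp: LinearCombinations.module_hom_def module_mat_simps)

lemma module_hom_index_expand:
  assumes \<Phi>: "\<Phi> \<in> LinearCombinations.module_hom class_ring (op_space d) (op_space d)"
    and X: "X \<in> carrier_mat d d" and ij: "i < d" "j < d"
  shows "\<Phi> X $$ (i, j) = (\<Sum>a<d. \<Sum>b<d. X $$ (a, b) * \<Phi> (munit d a b) $$ (i, j))"
proof -
  \<comment> \<open>\<open>R S\<close> keeps the entries of \<open>X\<close> at the positions in
    \<open>S\<close>. Adding a position adds one multiple of a matrix unit, which allows induction
    on \<open>S\<close>.\<close>
  define R where "R S = mat d d (\<lambda>p. if p \<in> S then X $$ p else 0)" for S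
  note hom = module_hom_op_spaceD[OF \<Phi>]
  have R: "R S \<in> carrier_mat d d" for S by (simp add: R_def)
  have "\<Phi> (R S) $$ (i, j) = (\<Sum>(a, b)\<in>S. X $$ (a, b) * \<Phi> (munit d a b) $$ (i, j))"
    if "finite S" "S \<subseteq> {..<d} \<times> {..<d}" for S
    using that
  proof (induction S rule: finite_induct)
    case empty
    \<comment> \<open>The image of the zero matrix is found from homogeneity with the scalar
      0.\<close>
    have "R {} = 0 \<cdot>\<^sub>m R {}" by (rule eq_matI) (auto simp: R_def)
    then have "\<Phi> (R {}) = 0 \<cdot>\<^sub>m \<Phi> (R {})" using hom(3)[OF R] by metis
    then have "\<Phi> (R {}) $$ (i, j) = (0 \<cdot>\<^sub>m \<Phi> (R {})) $$ (i, j)" by metis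
    then show ?case using ij hom(1)[OF R[of "{}"]] by simp
  next
    case (insert p S)
    obtain a b where p: "p = (a, b)" by (cases p)
    have ab: "a < d" "b < d" using insert p by auto
    have "R (insert p S) = X $$ p \<cdot>\<^sub>m munit d a b + R S"
      using insert(2) ab by (intro eq_matI) (auto simp: R_def munit_def p)
    then have "\<Phi> (R (insert p S)) = X $$ p \<cdot>\<^sub>m \<Phi> (munit d a b) + \<Phi> (R S)"
      by (simp add: hom(2,3) R)
    then have "\<Phi> (R (insert p S)) $$ (i, j) = X $$ p * \<Phi> (munit d a b) $$ (i, j) + \<Phi> (R S) $$ (i, j)"
      using ij hom(1)[OF R[of S]] hom(1)[OF munit_carrier[of d a b]] by simp
    then show ?case using insert p by simp
  qed
  from this[of "{..<d} \<times> {..<d}"]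
  have "\<Phi> (R ({..<d} \<times> {..<d})) $$ (i, j) = (\<Sum>a<d. \<Sum>b<d. X $$ (a, b) * \<Phi> (munit d a b) $$ (i, j))"
    by (simp add: sum.cartesian_product)
  moreover have "R ({..<d} \<times> {..<d}) = X" using X by (intro eq_matI) (auto simp: R_def)
  ultimately show ?thesis by simp
qed

lemma spectral_mat_index:
  assumes V: "V \<in> unitary_ops n" and rc: "r < n" "c < n"
  shows "spectral_mat n V l $$ (r, c) = (\<Sum>k<n. complex_of_real (l k) * V $$ (r, k) * cnj (V $$ (c, k)))"
proof -
  note Vc = unitary_opsD(1)[OF V]
  have VD: "(V * real_diag n l) $$ (r, k) = complex_of_real (l k) * V $$ (r, k)" if "k < n" for k
  proof -
    have "(V * real_diag n l) $$ (r, k) = (\<Sum>a<n. V $$ (r, a) * real_diag n l $$ (a, k))"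
      using Vc rc that by (intro mult_mat_index_sum) auto
    also have "\<dots> = (\<Sum>a<n. if a = k then complex_of_real (l k) * V $$ (r, k) else 0)"
      by (rule sum.cong) (use that in auto)
    finally show ?thesis using that by simp
  qed
  have "spectral_mat n V l $$ (r, c) = (\<Sum>k<n. (V * real_diag n l) $$ (r, k) * V\<^sup>H $$ (k, c))"
    unfolding spectral_mat_def using Vc rc
    by (intro mult_mat_index_sum) (auto intro: mult_carrier_mat[of _ n n])
  then show ?thesis using Vc rc VD by simp
qed

text \<open>Choi's construction: eigenvectors of the positive Choi matrix, scaled by the square
  roots of their eigenvalues and reshaped to matrices, are Kraus operators. Existence gives meaning
  to the \<open>SOME\<close> in \<open>kraus_space\<close>.\<close>

lemma kraus_rep_exists:
  assumes \<Phi>: "quantum_channel d \<Phi>"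
  shows "\<exists>Es. kraus_rep d \<Phi> Es"
proof -
  let ?N = "d * d"
  have hom: "\<Phi> \<in> LinearCombinations.module_hom class_ring (op_space d) (op_space d)"
    and cp: "completely_positive d \<Phi>" and tp: "trace_preserving d \<Phi>"
    using \<Phi> by (auto simp: quantum_channel_def)
  obtain V l where V: "V \<in> unitary_ops ?N" and J: "choi d \<Phi> = spectral_mat ?N V l"
    and l: "\<And>k. k < ?N \<Longrightarrow> 0 \<le> l k"
    using positive_op_spectral_mat[OF positive_op_choi[OF cp]] by blast
  define E where "E k = mat d d (\<lambda>(i, a). complex_of_real (sqrt (l k)) * V $$ (i * d + a, k))" for k
  define Es where "Es = map E [0..<?N]"
  have E: "E k \<in> carrier_mat d d" for k by (simp add: E_def)
  have Es: "length Es = ?N" "\<And>k. k < ?N \<Longrightarrow> Es ! k = E k" by (simp_all add: Es_def)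
  \<comment> \<open>On matrix units the Kraus formula is the spectral decomposition of the Choi
    matrix read entrywise; linearity then carries it to all \<open>X\<close>.\<close>
  have \<Phi>E: "\<Phi> (munit d a b) $$ (i, j) = (\<Sum>k<?N. E k $$ (i, a) * cnj (E k $$ (j, b)))"
    if "i < d" "j < d" "a < d" "b < d" for i j a b
  proof -
    have "\<Phi> (munit d a b) $$ (i, j) = choi d \<Phi> $$ (i * d + a, j * d + b)"
      using that by (simp add: choi_index pair_index_less)
    also have "\<dots> = (\<Sum>k<?N. complex_of_real (l k) * V $$ (i * d + a, k) * cnj (V $$ (j * d + b, k)))"
      unfolding J using that by (intro spectral_mat_index[OF V] pair_index_less)
    also have "\<dots> = (\<Sum>k<?N. E k $$ (i, a) * cnj (E k $$ (j, b)))"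
    proof (rule sum.cong)
      fix k assume "k \<in> {..<?N}"
      then have "complex_of_real (l k) = complex_of_real (sqrt (l k)) * complex_of_real (sqrt (l k))"
        using l by (simp flip: of_real_mult)
      then show "complex_of_real (l k) * V $$ (i * d + a, k) * cnj (V $$ (j * d + b, k))
          = E k $$ (i, a) * cnj (E k $$ (j, b))"
        using that by (simp add: E_def)
    qed simp
    finally show ?thesis .
  qed
  have "\<Phi> X = finsum (op_space d) (\<lambda>k. Es ! k * X * (Es ! k)\<^sup>H) {..<?N}"
    if X: "X \<in> carrier_mat d d" for X
  proof (rule eq_matI)
    have c: "Es ! k * X * (Es ! k)\<^sup>H \<in> carrier_mat d d" if "k \<in> {..<?N}" for k
      using that E X Es by (auto intro!: mult_carrier_mat[of _ d d])
    have fc: "finsum (op_space d) (\<lambda>k. Es ! k * X * (Es ! k)\<^sup>H) {..<?N} \<in> carrier_mat d d"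
      by (rule finsum_op_space_carrier) (use c in auto)
    show "dim_row (\<Phi> X) = dim_row (finsum (op_space d) (\<lambda>k. Es ! k * X * (Es ! k)\<^sup>H) {..<?N})"
      "dim_col (\<Phi> X) = dim_col (finsum (op_space d) (\<lambda>k. Es ! k * X * (Es ! k)\<^sup>H) {..<?N})"
      using fc module_hom_op_spaceD(1)[OF hom X] by auto
    fix i j assume "i < dim_row (finsum (op_space d) (\<lambda>k. Es ! k * X * (Es ! k)\<^sup>H) {..<?N})"
      "j < dim_col (finsum (op_space d) (\<lambda>k. Es ! k * X * (Es ! k)\<^sup>H) {..<?N})"
    then have ij: "i < d" "j < d" using fc by auto
    have "finsum (op_space d) (\<lambda>k. Es ! k * X * (Es ! k)\<^sup>H) {..<?N} $$ (i, j)
        = (\<Sum>k<?N. (Es ! k * X * (Es ! k)\<^sup>H) $$ (i, j))"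
      using ij c by (intro finsum_op_space_index) auto
    also have "\<dots> = (\<Sum>k<?N. \<Sum>a<d. \<Sum>b<d. X $$ (a, b) * (E k $$ (i, a) * cnj (E k $$ (j, b))))"
      by (rule sum.cong) (simp_all add: Es sandwich_index[OF E X E ij] del: index_mult_mat(1))
    also have "\<dots> = (\<Sum>a<d. \<Sum>k<?N. \<Sum>b<d. X $$ (a, b) * (E k $$ (i, a) * cnj (E k $$ (j, b))))"
      by (rule sum.swap)
    also have "\<dots> = (\<Sum>a<d. \<Sum>b<d. \<Sum>k<?N. X $$ (a, b) * (E k $$ (i, a) * cnj (E k $$ (j, b))))"
      by (rule sum.cong[OF refl]) (rule sum.swap)
    also have "\<dots> = (\<Sum>a<d. \<Sum>b<d. X $$ (a, b) * \<Phi> (munit d a b) $$ (i, j))"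
      using ij by (intro sum.cong refl) (simp add: \<Phi>E sum_distrib_left)
    also have "\<dots> = \<Phi> X $$ (i, j)" using module_hom_index_expand[OF hom X ij] by simp
    finally show "\<Phi> X $$ (i, j) = finsum (op_space d) (\<lambda>k. Es ! k * X * (Es ! k)\<^sup>H) {..<?N} $$ (i, j)"
      by simp
  qed
  \<comment> \<open>Entry \<open>(b, a)\<close> of this sum is the trace of
    \<open>\<Phi> (munit d a b)\<close>, so the completeness relation is trace preservation on
    matrix units.\<close>
  moreover have "finsum (op_space d) (\<lambda>k. (Es ! k)\<^sup>H * Es ! k) {..<?N} = 1\<^sub>m d"
  proof (rule eq_matI)
    have c: "(Es ! k)\<^sup>H * Es ! k \<in> carrier_mat d d" if "k \<in> {..<?N}" for k
      using that E Es by (auto intro!: mult_carrier_mat[of _ d d])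
    have fc: "finsum (op_space d) (\<lambda>k. (Es ! k)\<^sup>H * Es ! k) {..<?N} \<in> carrier_mat d d"
      by (rule finsum_op_space_carrier) (use c in auto)
    show "dim_row (finsum (op_space d) (\<lambda>k. (Es ! k)\<^sup>H * Es ! k) {..<?N}) = dim_row (1\<^sub>m d)"
      "dim_col (finsum (op_space d) (\<lambda>k. (Es ! k)\<^sup>H * Es ! k) {..<?N}) = dim_col (1\<^sub>m d)"
      using fc by auto
    fix b a assume "b < dim_row (1\<^sub>m d)" "a < dim_col (1\<^sub>m d)"
    then have ab: "a < d" "b < d" by auto
    have "finsum (op_space d) (\<lambda>k. (Es ! k)\<^sup>H * Es ! k) {..<?N} $$ (b, a)
        = (\<Sum>k<?N. ((Es ! k)\<^sup>H * Es ! k) $$ (b, a))"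
      using ab c by (intro finsum_op_space_index) auto
    also have "\<dots> = (\<Sum>k<?N. \<Sum>i<d. E k $$ (i, a) * cnj (E k $$ (i, b)))"
    proof (rule sum.cong)
      fix k assume k: "k \<in> {..<?N}"
      have "((E k)\<^sup>H * E k) $$ (b, a) = (\<Sum>i<d. (E k)\<^sup>H $$ (b, i) * E k $$ (i, a))"
        using ab E by (intro mult_mat_index_sum) auto
      then show "((Es ! k)\<^sup>H * Es ! k) $$ (b, a) = (\<Sum>i<d. E k $$ (i, a) * cnj (E k $$ (i, b)))"
        using k ab E[of k] by (simp add: Es mult_ac del: index_mult_mat(1))
    qed simp
    also have "\<dots> = (\<Sum>i<d. \<Sum>k<?N. E k $$ (i, a) * cnj (E k $$ (i, b)))" by (rule sum.swap)
    also have "\<dots> = (\<Sum>i<d. \<Phi> (munit d a b) $$ (i, i))" using ab by (simp add: \<Phi>E)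
    also have "\<dots> = mat_trace (\<Phi> (munit d a b))"
      using module_hom_op_spaceD(1)[OF hom munit_carrier] by (simp add: mat_trace_sum[of _ d])
    also have "\<dots> = mat_trace (munit d a b)" using tp by (simp add: trace_preserving_def)
    also have "\<dots> = (\<Sum>i<d. if i = a then (if a = b then 1 else 0) else 0)"
      unfolding mat_trace_sum[OF munit_carrier] by (rule sum.cong) (auto simp: munit_def)
    finally show "finsum (op_space d) (\<lambda>k. (Es ! k)\<^sup>H * Es ! k) {..<?N} $$ (b, a) = 1\<^sub>m d $$ (b, a)"
      using ab by simp
  qed
  moreover have "set Es \<subseteq> carrier_mat d d" using E by (auto simp: Es_def)
  ultimately have "kraus_rep d \<Phi> Es" by (simp add: kraus_rep_def Es)
  then show ?thesis by blast
qed

text \<open>Its column space is the vectorized Kraus space.\<close>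

definition kraus_mat :: "nat \<Rightarrow> complex mat list \<Rightarrow> complex mat" where
  "kraus_mat d Es = mat (d * d) (length Es) (\<lambda>(r, k). vecop d (Es ! k) $ r)"

lemma kraus_mat_carrier [simp]: "kraus_mat d Es \<in> carrier_mat (d * d) (length Es)"
  by (simp add: kraus_mat_def)

text \<open>On matrix units each Kraus term is a product of one entry and one conjugated entry.
  Consequently a projection that fixes \<open>kraus_mat d Es\<close> also fixes the Choi
  matrix.\<close>

lemma choi_kraus_rep:
  assumes "kraus_rep d \<Phi> Es"
  shows "choi d \<Phi> = kraus_mat d Es * (kraus_mat d Es)\<^sup>H"
proof (rule eq_matI)
  let ?m = "length Es" and ?M = "kraus_mat d Es"
  have Es: "Es ! k \<in> carrier_mat d d" if "k < ?m" for k
    using assms that by (auto simp: kraus_rep_def)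
  fix r c assume "r < dim_row (?M * ?M\<^sup>H)" "c < dim_col (?M * ?M\<^sup>H)"
  then have rc: "r < d * d" "c < d * d" by (auto simp: kraus_mat_def)
  note b = pair_index_bounds[OF rc(1)] pair_index_bounds[OF rc(2)]
  let ?X = "munit d (r mod d) (c mod d)"
  have "choi d \<Phi> $$ (r, c) = \<Phi> ?X $$ (r div d, c div d)" using rc by (rule choi_index)
  also have "\<Phi> ?X = finsum (op_space d) (\<lambda>k. Es ! k * ?X * (Es ! k)\<^sup>H) {..<?m}"
    using assms by (simp add: kraus_rep_def)
  also have "\<dots> $$ (r div d, c div d) = (\<Sum>k<?m. (Es ! k * ?X * (Es ! k)\<^sup>H) $$ (r div d, c div d))"
    using b Es by (intro finsum_op_space_index) (auto intro!: mult_carrier_mat[of _ d d])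
  also have "\<dots> = (\<Sum>k<?m. ?M $$ (r, k) * ?M\<^sup>H $$ (k, c))"
    using b rc Es by (intro sum.cong refl) (simp add: sandwich_munit_index kraus_mat_def del: index_mult_mat(1))
  also have "\<dots> = (?M * ?M\<^sup>H) $$ (r, c)"
    using rc by (intro mult_mat_index_sum[symmetric, of _ "d * d" ?m _ "d * d"]) auto
  finally show "choi d \<Phi> $$ (r, c) = (?M * ?M\<^sup>H) $$ (r, c)" .
qed (auto simp: choi_def ampliation_def kraus_mat_def)

text \<open>Turns membership in the span into a linear equation for \<open>P\<close>. The fixed
  space is a submodule containing the generators; conversely, the factorization of \<open>P\<close>
  writes every fixed vector as a combination of columns.\<close>

lemma span_kraus_mat:
  assumes Es: "set Es \<subseteq> carrier_mat d d"
    and P: "P \<in> carrier_mat (d * d) (d * d)" "P * kraus_mat d Es = kraus_mat d Es"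
    and B: "B \<in> carrier_mat (length Es) (d * d)" "P = kraus_mat d Es * B"
  shows "LinearCombinations.module.span class_ring (op_space d) (set Es) =
    {L \<in> carrier_mat d d. P *\<^sub>v vecop d L = vecop d L}" (is "?K = ?F")
proof -
  let ?m = "length Es" and ?M = "kraus_mat d Es" and ?N = "d * d"
  interpret K: matrix_vs d d "TYPE(complex)" .
  have Es': "Es ! k \<in> carrier_mat d d" if "k < ?m" for k using Es that by auto
  have col: "col ?M k = vecop d (Es ! k)" if "k < ?m" for k
    using that by (intro eq_vecI) (auto simp: kraus_mat_def)
  have vadd: "vecop d (A + C) = vecop d A + vecop d C" if "A \<in> carrier_mat d d" "C \<in> carrier_mat d d" for A C
    using that by (intro eq_vecI) (auto simp: pair_index_bounds)
  have vsm: "vecop d (c \<cdot>\<^sub>m A) = c \<cdot>\<^sub>v vecop d A" if "A \<in> carrier_mat d d" for A c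
    using that by (intro eq_vecI) (auto simp: pair_index_bounds)
  show ?thesis
  proof
    have "submodule class_ring ?F (op_space d)"
    proof
      show "?F \<subseteq> carrier (op_space d)" by (auto simp: module_mat_simps)
      show "\<zero>\<^bsub>op_space d\<^esub> \<in> ?F"
      proof -
        have "vecop d (0\<^sub>m d d) = 0\<^sub>v ?N" by (intro eq_vecI) (auto simp: pair_index_bounds)
        moreover have "P *\<^sub>v 0\<^sub>v ?N = 0\<^sub>v ?N"
          using P(1) by (intro eq_vecI) auto
        ultimately show ?thesis by (simp add: module_mat_simps)
      qed
      fix A C assume "A \<in> ?F" "C \<in> ?F"
      then show "A \<oplus>\<^bsub>op_space d\<^esub> C \<in> ?F"
        using P(1) by (auto simp: module_mat_simps vadd mult_add_distrib_mat_vec[of _ ?N ?N])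
    next
      fix A c assume "A \<in> ?F"
      then show "c \<odot>\<^bsub>op_space d\<^esub> A \<in> ?F"
        using P(1) by (auto simp: module_mat_simps vsm mult_mat_vec[of _ ?N ?N])
    qed
    moreover have "set Es \<subseteq> ?F"
    proof
      fix A assume "A \<in> set Es"
      then obtain k where k: "k < ?m" "A = Es ! k" by (auto simp: in_set_conv_nth)
      have "P *\<^sub>v col ?M k = col (P * ?M) k"
        using P(1) k by (intro col_mult2[symmetric, of _ ?N ?N _ ?m]) auto
      then show "A \<in> ?F" using k Es' col P(2) by simp
    qed
    ultimately show "?K \<subseteq> ?F" by (rule K.span_is_subset[rotated])
  next
    have sub: "submodule class_ring ?K (op_space d)"
      by (rule K.span_is_submodule) (rule Es)
    have own: "set Es \<subseteq> ?K" by (rule K.in_own_span) (rule Es)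
    show "?F \<subseteq> ?K"
    proof
      fix L assume "L \<in> ?F"
      then have L: "L \<in> carrier_mat d d" "P *\<^sub>v vecop d L = vecop d L" by auto
      \<comment> \<open>The coefficients of \<open>L\<close> with respect to the generators.\<close>
      define x where "x = B *\<^sub>v vecop d L"
      have x: "x \<in> carrier_vec ?m" using B(1) by (auto simp: x_def intro!: mult_mat_vec_carrier)
      have vL: "vecop d L = ?M *\<^sub>v x"
        unfolding x_def using L(2) B by (simp add: assoc_mult_mat_vec[of _ ?N ?m _ ?N])
      \<comment> \<open>Partial sums, so that closure of the span under sums and multiples suffices
        by induction on \<open>q\<close>.\<close>
      define S where "S q = mat d d (\<lambda>(i, a). \<Sum>k<q. x $ k * (Es ! k) $$ (i, a))" for q
      have "S q \<in> ?K" if "q \<le> ?m" for q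
        using that
      proof (induction q)
        case 0
        have "S 0 = 0\<^sub>m d d" by (rule eq_matI) (auto simp: S_def)
        then show ?case using submodule.zero_closed[OF sub] by (simp add: module_mat_simps)
      next
        case (Suc q)
        have "S (Suc q) = S q + x $ q \<cdot>\<^sub>m Es ! q"
          using Es'[of q] Suc by (intro eq_matI) (auto simp: S_def)
        moreover have "x $ q \<cdot>\<^sub>m Es ! q \<in> ?K"
          using submodule.smult_closed[OF sub, of "x $ q" "Es ! q"] subsetD[OF own, of "Es ! q"] Suc
          by (simp add: module_mat_simps)
        ultimately show ?case
          using submodule.m_closed[OF sub, of "S q" "x $ q \<cdot>\<^sub>m Es ! q"] Suc by (simp add: module_mat_simps)
      qed
      moreover have "S ?m = L"
      proof (rule eq_matI)
        fix i a assume "i < dim_row L" "a < dim_col L"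
        then have ia: "i < d" "a < d" using L by auto
        have "L $$ (i, a) = vecop d L $ (i * d + a)" using ia by (simp add: pair_index_less)
        also have "\<dots> = (\<Sum>k<?m. ?M $$ (i * d + a, k) * x $ k)"
          unfolding vL using x ia by (intro mult_mat_vec_index_sum[of _ ?N]) (auto simp: pair_index_less)
        also have "\<dots> = S ?m $$ (i, a)"
        proof -
          have "?M $$ (i * d + a, k) = (Es ! k) $$ (i, a)" if "k < ?m" for k
            using ia that by (simp add: kraus_mat_def pair_index_less)
          then show ?thesis using ia by (simp add: S_def mult.commute)
        qed
        finally show "S ?m $$ (i, a) = L $$ (i, a)" by simp
      qed (use L in \<open>auto simp: S_def\<close>)
      ultimately show "L \<in> ?K" by auto
    qed
  qed
qed

subsection \<open>Compactness of the set of contractions\<close>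

text \<open>Bolzano-Weierstrass one coordinate at a time: a bounded monotone subsequence settles the
  new coordinate, and passing to it preserves the limits already found.\<close>

lemma real_families_convergent_subseq:
  fixes f :: "nat \<Rightarrow> 'i \<Rightarrow> real"
  assumes "finite I" "\<And>n i. i \<in> I \<Longrightarrow> \<bar>f n i\<bar> \<le> B"
  shows "\<exists>r g. strict_mono r \<and> (\<forall>i\<in>I. (\<lambda>n. f (r n) i) \<longlonglongrightarrow> g i)"
  using assms
proof (induction I rule: finite_induct)
  case empty
  show ?case by (rule exI[of _ "\<lambda>n. n"]) (auto simp: strict_mono_def)
next
  case (insert x I)
  then obtain r g where r: "strict_mono r" and g: "\<And>i. i \<in> I \<Longrightarrow> (\<lambda>n. f (r n) i) \<longlonglongrightarrow> g i"
    by (metis insertCI)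
  obtain s where s: "strict_mono s" "monoseq (\<lambda>n. f (r (s n)) x)"
    using seq_monosub[of "\<lambda>n. f (r n) x"] by auto
  have "Bseq (\<lambda>n. f (r (s n)) x)" by (rule BseqI'[of _ B]) (use insert in auto)
  then obtain y where y: "(\<lambda>n. f (r (s n)) x) \<longlonglongrightarrow> y"
    using Bseq_monoseq_convergent[OF _ s(2)] by (auto simp: convergent_def)
  have "(\<lambda>n. f (r (s n)) i) \<longlonglongrightarrow> (g(x := y)) i" if "i \<in> insert x I" for i
    using that y LIMSEQ_subseq_LIMSEQ[OF g s(1)] by (cases "i = x") (auto simp: o_def)
  moreover have "strict_mono (r \<circ> s)" using r s(1) by (rule strict_mono_o)
  ultimately show ?case
    by (intro exI[of _ "r \<circ> s"] exI[of _ "g(x := y)"]) (simp add: o_def)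
qed

text \<open>Real and imaginary parts form a single real family over the disjoint sum
  \<open>I <+> I\<close>.\<close>

lemma complex_families_convergent_subseq:
  fixes f :: "nat \<Rightarrow> 'i \<Rightarrow> complex"
  assumes I: "finite I" and B: "\<And>n i. i \<in> I \<Longrightarrow> cmod (f n i) \<le> B"
  shows "\<exists>r g. strict_mono r \<and> (\<forall>i\<in>I. (\<lambda>n. f (r n) i) \<longlonglongrightarrow> g i)"
proof -
  let ?h = "\<lambda>n. case_sum (\<lambda>i. Re (f n i)) (\<lambda>i. Im (f n i))"
  have "\<bar>?h n k\<bar> \<le> B" if k: "k \<in> I <+> I" for n k
  proof -
    obtain i where "i \<in> I" "k = Inl i \<or> k = Inr i" using k by auto
    then show ?thesis
      using B[of i n] abs_Re_le_cmod[of "f n i"] abs_Im_le_cmod[of "f n i"] by auto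
  qed
  from real_families_convergent_subseq[of "I <+> I" ?h B, OF finite_Plus[OF I I] this]
  obtain r g where r: "strict_mono r" and g: "\<And>k. k \<in> I <+> I \<Longrightarrow> (\<lambda>n. ?h (r n) k) \<longlonglongrightarrow> g k"
    by blast
  have "(\<lambda>n. f (r n) i) \<longlonglongrightarrow> Complex (g (Inl i)) (g (Inr i))" if "i \<in> I" for i
    unfolding tendsto_complex_iff using g[of "Inl i"] g[of "Inr i"] that by auto
  with r show ?thesis by (intro exI[of _ r] exI[of _ "\<lambda>i. Complex (g (Inl i)) (g (Inr i))"]) simp
qed

text \<open>Column \<open>j\<close> is the image of a unit vector and so has norm at most 1.\<close>

lemma contraction_index_le_1:
  assumes Q: "contraction n Q" and ij: "i < n" "j < n"
  shows "cmod (Q $$ (i, j)) \<le> 1"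
proof -
  note Qc = contractionD(1)[OF Q]
  have Qe: "Q *\<^sub>v unit_vec n j = col Q j"
    by (rule eq_vecI) (use Qc ij in \<open>auto simp: scalar_prod_right_unit[of _ n]\<close>)
  have "(cmod (Q $$ (i, j)))\<^sup>2 \<le> (\<Sum>i<n. (cmod (col Q j $ i))\<^sup>2)"
    using Qc ij member_le_sum[of i "{..<n}" "\<lambda>i. (cmod (col Q j $ i))\<^sup>2"] by simp
  also have "\<dots> = Re (col Q j \<bullet>c col Q j)"
    using Qc ij by (intro Re_cscalar_prod_self[symmetric]) auto
  also have "\<dots> \<le> Re (unit_vec n j \<bullet>c unit_vec n j)"
    using contractionD(2)[OF Q, of "unit_vec n j"] by (simp add: Qe)
  also have "\<dots> = (\<Sum>i<n. if i = j then 1 else 0)"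
    unfolding Re_cscalar_prod_self[OF unit_vec_carrier] by (rule sum.cong) (use ij in auto)
  finally show ?thesis using ij by (simp add: power_le_one_iff)
qed

text \<open>For fixed \<open>v\<close> the squared norm of \<open>Q v\<close> depends continuously
  on the entries of \<open>Q\<close>, so the inequality survives the limit.\<close>

lemma contraction_limit:
  assumes Q: "\<And>k. contraction n (Q k)" and R: "R \<in> carrier_mat n n"
    and lim: "\<And>i j. i < n \<Longrightarrow> j < n \<Longrightarrow> (\<lambda>k. Q k $$ (i, j)) \<longlonglongrightarrow> R $$ (i, j)"
  shows "contraction n R"
  unfolding contraction_def
proof (intro conjI ballI R)
  fix v :: "complex vec" assume v: "v \<in> carrier_vec n"
  have nrm: "Re ((A *\<^sub>v v) \<bullet>c (A *\<^sub>v v)) = (\<Sum>i<n. (cmod (\<Sum>j<n. A $$ (i, j) * v $ j))\<^sup>2)"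
    if "A \<in> carrier_mat n n" for A
    using that v mult_mat_vec_carrier[OF that v]
    by (subst Re_cscalar_prod_self[of _ n]) (auto simp: mult_mat_vec_index_sum simp del: index_mult_mat_vec)
  have "(\<lambda>k. Re ((Q k *\<^sub>v v) \<bullet>c (Q k *\<^sub>v v))) \<longlonglongrightarrow> Re ((R *\<^sub>v v) \<bullet>c (R *\<^sub>v v))"
    unfolding nrm[OF contractionD(1)[OF Q]] nrm[OF R] by (intro tendsto_intros lim) auto
  then show "Re ((R *\<^sub>v v) \<bullet>c (R *\<^sub>v v)) \<le> Re (v \<bullet>c v)"
    by (rule LIMSEQ_le_const2) (use contractionD(2)[OF Q v] in auto)
qed

text \<open>A maximizing sequence has an entrywise convergent subsequence, whose limit is again a
  contraction and attains the supremum by continuity.\<close>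

lemma contraction_maximizer:
  assumes P: "P \<in> carrier_mat (d * d) (d * d)"
  shows "\<exists>Q. contraction d Q \<and> (\<forall>R. contraction d R \<longrightarrow>
    Re ((P *\<^sub>v vecop d R) \<bullet>c vecop d R) \<le> Re ((P *\<^sub>v vecop d Q) \<bullet>c vecop d Q))"
proof -
  let ?N = "d * d"
  define e where "e Q r = Q $$ (r div d, r mod d)" for Q :: "complex mat" and r
  define g where "g Q = Re ((P *\<^sub>v vecop d Q) \<bullet>c vecop d Q)" for Q
  \<comment> \<open>As a finite sum in the entries of \<open>Q\<close>, the form displays both its
    boundedness on contractions and its continuity.\<close>
  have g: "g Q = Re (\<Sum>r<?N. (\<Sum>c<?N. P $$ (r, c) * e Q c) * cnj (e Q r))" for Q
    unfolding g_def using P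
    by (subst cscalar_prod_sum[OF vecop_carrier(1)])
      (simp add: mult_mat_vec_index_sum[OF P vecop_carrier(1)] e_def del: index_mult_mat_vec)
  have e1: "cmod (e Q r) \<le> 1" if "contraction d Q" "r < ?N" for Q r
    unfolding e_def using that by (intro contraction_index_le_1[of d] pair_index_bounds)
  define G where "G = g ` {Q. contraction d Q}"
  have "contraction d (1\<^sub>m d)" by (intro unitary_contraction unitary_opsI) auto
  then have G0: "G \<noteq> {}" by (auto simp: G_def)
  have "g Q \<le> (\<Sum>r<?N. (\<Sum>c<?N. cmod (P $$ (r, c)) * 1) * 1)" if Q: "contraction d Q" for Q
  proof -
    have "g Q \<le> cmod (\<Sum>r<?N. (\<Sum>c<?N. P $$ (r, c) * e Q c) * cnj (e Q r))"
      unfolding g by (rule complex_Re_le_cmod)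
    also have "\<dots> \<le> (\<Sum>r<?N. (\<Sum>c<?N. cmod (P $$ (r, c)) * 1) * 1)"
    proof (rule sum_norm_le)
      fix r assume r: "r \<in> {..<?N}"
      have "cmod (\<Sum>c<?N. P $$ (r, c) * e Q c) \<le> (\<Sum>c<?N. cmod (P $$ (r, c)) * 1)"
        by (rule sum_norm_le) (unfold norm_mult, rule mult_left_mono, use e1[OF Q] in auto)
      then show "cmod ((\<Sum>c<?N. P $$ (r, c) * e Q c) * cnj (e Q r)) \<le> (\<Sum>c<?N. cmod (P $$ (r, c)) * 1) * 1"
        unfolding norm_mult complex_mod_cnj using e1[OF Q] r by (intro mult_mono) (auto intro: sum_nonneg)
    qed
    finally show ?thesis .
  qed
  then have bdd: "bdd_above G" by (auto simp: G_def intro!: bdd_aboveI)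
  have "\<exists>Q. contraction d Q \<and> Sup G - inverse (real (Suc n)) < g Q" for n
  proof -
    have "Sup G - inverse (real (Suc n)) < Sup G" by simp
    then obtain y where "y \<in> G" "Sup G - inverse (real (Suc n)) < y"
      using less_cSupE[OF _ G0] by blast
    then show ?thesis by (auto simp: G_def)
  qed
  then obtain Q where Q: "\<And>n. contraction d (Q n)" and gQ: "\<And>n. Sup G - inverse (real (Suc n)) < g (Q n)"
    by metis
  have "cmod (Q n $$ p) \<le> 1" if "p \<in> {..<d} \<times> {..<d}" for n p
    using that contraction_index_le_1[OF Q] by auto
  from complex_families_convergent_subseq[of "{..<d} \<times> {..<d}" "\<lambda>n p. Q n $$ p" 1, OF _ this]
  obtain r q where r: "strict_mono r"
    and q: "\<And>p. p \<in> {..<d} \<times> {..<d} \<Longrightarrow> (\<lambda>n. Q (r n) $$ p) \<longlonglongrightarrow> q p"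
    by (metis finite_SigmaI finite_lessThan)
  define R where "R = mat d d q"
  have R: "R \<in> carrier_mat d d" by (simp add: R_def)
  have lim: "(\<lambda>n. Q (r n) $$ (i, j)) \<longlonglongrightarrow> R $$ (i, j)" if "i < d" "j < d" for i j
    using q[of "(i, j)"] that by (simp add: R_def)
  have Rc: "contraction d R" by (rule contraction_limit[of d "\<lambda>n. Q (r n)"]) (use Q R lim in auto)
  have elim: "(\<lambda>n. e (Q (r n)) k) \<longlonglongrightarrow> e R k" if "k < ?N" for k
    unfolding e_def using pair_index_bounds[OF that] by (rule lim)
  have "(\<lambda>n. g (Q (r n))) \<longlonglongrightarrow> g R"
    unfolding g by (intro tendsto_intros elim) auto
  moreover have "(\<lambda>n. Sup G - inverse (real (Suc (r n)))) \<longlonglongrightarrow> Sup G - 0"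
    using LIMSEQ_subseq_LIMSEQ[OF LIMSEQ_inverse_real_of_nat r]
    by (intro tendsto_intros) (simp add: o_def)
  ultimately have "Sup G - 0 \<le> g R"
    using gQ by (intro LIMSEQ_le[of _ "Sup G - 0" _ "g R"]) (auto intro: less_imp_le)
  moreover have "g S \<le> Sup G" if "contraction d S" for S
    using that bdd by (intro cSup_upper) (auto simp: G_def)
  ultimately show ?thesis using Rc unfolding g_def by (intro exI[of _ R]) (auto intro: order_trans)
qed

section \<open>Traces of contractions\<close>

lemma positive_op_one_minus_contraction:
  assumes Q: "contraction n Q"
  shows "positive_op n (1\<^sub>m n - Q\<^sup>H * Q)"
  unfolding positive_op_def
proof (intro conjI ballI)
  note Qc = contractionD(1)[OF Q]
  have QQ: "Q\<^sup>H * Q \<in> carrier_mat n n" by (intro mult_carrier_mat[of _ n n] adjoint_carrier Qc)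
  then show "1\<^sub>m n - Q\<^sup>H * Q \<in> carrier_mat n n" by (rule minus_carrier_mat)
  fix v :: "complex vec" assume v: "v \<in> carrier_vec n"
  have Qv: "Q *\<^sub>v v \<in> carrier_vec n" using Qc v by (rule mult_mat_vec_carrier)
  have QQv: "(Q\<^sup>H * Q) *\<^sub>v v \<in> carrier_vec n" using QQ v by (rule mult_mat_vec_carrier)
  have "((1\<^sub>m n - Q\<^sup>H * Q) *\<^sub>v v) \<bullet>c v = v \<bullet>c v - ((Q\<^sup>H * Q) *\<^sub>v v) \<bullet>c v"
    using v QQ QQv by (simp add: minus_mult_distrib_mat_vec[of _ n n] minus_scalar_prod_distrib[of _ n])
  also have "\<dots> = complex_of_real (Re (v \<bullet>c v) - Re ((Q *\<^sub>v v) \<bullet>c (Q *\<^sub>v v)))"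
    unfolding adjoint_mult_self_quadratic[OF Qc v] of_real_diff
    by (simp only: cscalar_prod_self[OF v, symmetric] cscalar_prod_self[OF Qv, symmetric])
  finally show "0 \<le> ((1\<^sub>m n - Q\<^sup>H * Q) *\<^sub>v v) \<bullet>c v"
    using contractionD(2)[OF Q v]
    by (simp only: less_eq_complex_def Re_complex_of_real Im_complex_of_real zero_complex.simps diff_ge_0_iff_ge)
qed

lemma positive_op_trace_ge_0:
  assumes "positive_op n A"
  shows "0 \<le> Re (mat_trace A)"
proof -
  obtain V l where V: "V \<in> unitary_ops n" "A = spectral_mat n V l" and l: "\<And>i. i < n \<Longrightarrow> 0 \<le> l i"
    using positive_op_spectral_mat[OF assms(1)] by blast
  have "0 \<le> (\<Sum>i<n. l i)" using l by (intro sum_nonneg) auto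
  then show ?thesis by (simp only: V(2) mat_trace_spectral_mat[OF V(1)] Re_complex_of_real)
qed

lemma contraction_trace_le:
  assumes Q: "contraction n Q"
  shows "Re (mat_trace (Q\<^sup>H * Q)) \<le> n"
proof -
  have QQ: "Q\<^sup>H * Q \<in> carrier_mat n n"
    by (intro mult_carrier_mat[of _ n n] adjoint_carrier contractionD(1)[OF Q])
  show ?thesis
    using positive_op_trace_ge_0[OF positive_op_one_minus_contraction[OF Q]] QQ
    by (simp add: mat_trace_diff[of _ n])
qed

text \<open>The positive operator \<open>1 - Q\<^sup>H Q\<close> has trace 0 and therefore
  vanishes.\<close>

lemma contraction_unitaryI:
  assumes Q: "contraction n Q" and tr: "mat_trace (Q\<^sup>H * Q) = of_nat n"
  shows "Q \<in> unitary_ops n"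
proof (rule unitary_opsI)
  show Qc: "Q \<in> carrier_mat n n" by (rule contractionD(1)[OF Q])
  have QQ: "Q\<^sup>H * Q \<in> carrier_mat n n" by (intro mult_carrier_mat[of _ n n] adjoint_carrier Qc)
  have z: "1\<^sub>m n - Q\<^sup>H * Q = 0\<^sub>m n n"
    using QQ tr by (intro positive_op_trace_eq_0D positive_op_one_minus_contraction Q)
      (simp add: mat_trace_diff[of _ n])
  show "Q\<^sup>H * Q = 1\<^sub>m n"
  proof (rule eq_matI)
    fix i j assume ij: "i < dim_row (1\<^sub>m n)" "j < dim_col (1\<^sub>m n)"
    have "(1\<^sub>m n - Q\<^sup>H * Q) $$ (i, j) = 0" using z ij by simp
    moreover have "(1\<^sub>m n - Q\<^sup>H * Q) $$ (i, j) = 1\<^sub>m n $$ (i, j) - (Q\<^sup>H * Q) $$ (i, j)"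
      using ij QQ by (intro index_minus_mat) auto
    ultimately show "(Q\<^sup>H * Q) $$ (i, j) = 1\<^sub>m n $$ (i, j)" by simp
  qed (use Qc in auto)
qed

subsection \<open>Distance to the mixed-unitary channels\<close>

text \<open>\<open>Z\<close> is an orthogonal projection of trace 1, so \<open>|Z| = Z\<close>. It
  is the input on which the diamond norm is tested.\<close>

lemma trace_norm_max_entangled:
  assumes d: "1 \<le> d"
  defines "Z \<equiv> complex_of_real (1 / d) \<cdot>\<^sub>m max_entangled d"
  shows "trace_norm Z = 1"
proof -
  let ?N = "d * d"
  let ?\<Omega> = "max_entangled d"
  have diag: "(\<Sum>r<?N. if r div d = r mod d then 1 else 0) = (of_nat d :: complex)"
    using sum_pair_index[of "\<lambda>i a. if i = a then 1 else 0 :: complex" d] by simp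
  have Z: "Z \<in> carrier_mat ?N ?N" by (simp add: Z_def)
  have "Z\<^sup>H = Z" unfolding Z_def adjoint_smult by (rule eq_matI) (auto simp: max_entangled_def)
  moreover have "Z * Z = Z"
  proof (rule eq_matI)
    fix r c assume "r < dim_row Z" "c < dim_col Z"
    then have rc: "r < ?N" "c < ?N" using Z by auto
    have "(Z * Z) $$ (r, c) = (\<Sum>l<?N. Z $$ (r, l) * Z $$ (l, c))"
      using Z Z rc by (rule mult_mat_index_sum)
    also have "\<dots> = (\<Sum>l<?N. Z $$ (r, c) * complex_of_real (1 / d) * (if l div d = l mod d then 1 else 0))"
      by (rule sum.cong) (use rc in \<open>auto simp: Z_def max_entangled_def\<close>)
    also have "\<dots> = Z $$ (r, c) * complex_of_real (1 / d) * of_nat d"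
      by (simp only: sum_distrib_left[symmetric] diag)
    finally show "(Z * Z) $$ (r, c) = Z $$ (r, c)" using d by simp
  qed (use Z in auto)
  ultimately have "trace_norm Z = Re (mat_trace Z)"
    using mat_abs_projection[OF Z] by (simp add: trace_norm_def)
  also have "mat_trace Z = (\<Sum>r<?N. complex_of_real (1 / d) * (if r div d = r mod d then 1 else 0))"
    unfolding mat_trace_sum[OF Z] by (rule sum.cong) (auto simp: Z_def max_entangled_def)
  also have "\<dots> = 1" using d by (simp only: sum_distrib_left[symmetric] diag) simp
  finally show ?thesis by simp
qed

text \<open>One choice bounds each supremum from below: \<open>n = d\<close> in the diamond norm,
  the maximally entangled state \<open>Z\<close> in the induced norm, and the contraction
  \<open>P - 1\<close> in trace norm duality.\<close>

lemma mixed_unitary_distance_ge: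
  assumes \<Phi>: "quantum_channel d \<Phi>" and d: "1 \<le> d"
    and P: "P \<in> carrier_mat (d * d) (d * d)" "P\<^sup>H = P" "P * P = P" "P * choi d \<Phi> = choi d \<Phi>"
    and bound: "\<And>U. U \<in> unitary_ops d \<Longrightarrow> real d * C \<le> real d - Re ((P *\<^sub>v vecop d U) \<bullet>c vecop d U)"
    and \<Psi>: "\<Psi> \<in> map_convex_hull d (unitary_channels d)"
  shows "ereal C \<le> channel_dist d \<Phi> \<Psi>"
proof -
  let ?N = "d * d" and ?T = "\<lambda>X. \<Phi> X - \<Psi> X" and ?c = "complex_of_real (1 / d)"
  have hom: "\<Phi> \<in> LinearCombinations.module_hom class_ring (op_space d) (op_space d)"
    using \<Phi> by (auto simp: quantum_channel_def)
  obtain m :: nat and p :: "nat \<Rightarrow> real" and F where p: "\<And>k. k < m \<Longrightarrow> 0 \<le> p k" "(\<Sum>k<m. p k) = 1"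
    and F: "\<And>k. k < m \<Longrightarrow> F k \<in> unitary_channels d"
    and \<Psi>F: "\<And>X. X \<in> carrier_mat d d \<Longrightarrow>
      \<Psi> X = finsum (op_space d) (\<lambda>k. complex_of_real (p k) \<cdot>\<^sub>m F k X) {..<m}"
    using \<Psi> unfolding map_convex_hull_def by blast
  have "\<forall>k. \<exists>U. k < m \<longrightarrow> U \<in> unitary_ops d \<and> F k = (\<lambda>X. U * X * U\<^sup>H)"
    using F by (auto simp: unitary_channels_def)
  then obtain U where U: "\<And>k. k < m \<Longrightarrow> U k \<in> unitary_ops d"
    and FU: "\<And>k. k < m \<Longrightarrow> F k = (\<lambda>X. U k * X * (U k)\<^sup>H)"
    by metis
  note Uc = unitary_opsD(1)[OF U]
  define u where "u k = vecop d (U k)" for k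
  have u: "u k \<in> carrier_vec ?N" for k by (simp add: u_def)
  \<comment> \<open>The Choi matrix of \<open>\<Psi>\<close>, expressed through the vectorized
    unitaries.\<close>
  define S where "S = mat ?N ?N (\<lambda>(r, c). \<Sum>k<m. complex_of_real (p k) * (u k $ r * cnj (u k $ c)))"
  have S: "S \<in> carrier_mat ?N ?N" by (simp add: S_def)
  define Z where "Z = ?c \<cdot>\<^sub>m max_entangled d"
  have Z: "Z \<in> carrier_mat ?N ?N" by (simp add: Z_def)
  have UXU: "U k * X * (U k)\<^sup>H \<in> carrier_mat d d" if "X \<in> carrier_mat d d" "k < m" for X k
    using that Uc by (intro mult_carrier_mat[of _ d d] adjoint_carrier) auto
  have \<Psi>1: "\<Psi> X \<in> carrier_mat d d" if "X \<in> carrier_mat d d" for X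
    unfolding \<Psi>F[OF that] by (intro finsum_op_space_carrier) (auto simp: FU UXU that)
  \<comment> \<open>Membership in the hull prescribes values of \<open>\<Psi>\<close>, so scaled
    matrix units are evaluated through the convex combination; the scalar is pulled out of each
    unitary channel.\<close>
  have \<Psi>2: "\<Psi> (?c \<cdot>\<^sub>m munit d a b) $$ (i, j) = ?c * (\<Sum>k<m. complex_of_real (p k) * (U k $$ (i, a) * cnj (U k $$ (j, b))))"
    if "i < d" "j < d" "a < d" "b < d" for i j a b
  proof -
    have "\<Psi> (?c \<cdot>\<^sub>m munit d a b) $$ (i, j)
        = (\<Sum>k<m. (complex_of_real (p k) \<cdot>\<^sub>m F k (?c \<cdot>\<^sub>m munit d a b)) $$ (i, j))"
      using that by (subst \<Psi>F, simp, intro finsum_op_space_index) (auto simp: FU UXU)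
    also have "\<dots> = (\<Sum>k<m. ?c * (complex_of_real (p k) * (U k $$ (i, a) * cnj (U k $$ (j, b)))))"
    proof (rule sum.cong)
      fix k assume "k \<in> {..<m}"
      then have k: "k < m" by simp
      have s: "U k * munit d a b * (U k)\<^sup>H \<in> carrier_mat d d" "U k * munit d a b \<in> carrier_mat d d"
        using Uc[OF k] by (auto intro!: mult_carrier_mat[of _ d d])
      have "F k (?c \<cdot>\<^sub>m munit d a b) = ?c \<cdot>\<^sub>m (U k * munit d a b * (U k)\<^sup>H)"
        using Uc[OF k] s by (simp add: FU[OF k] mult_smult_distrib[of _ d d _ d] mult_smult_assoc_mat[of _ d d _ d])
      then have "(complex_of_real (p k) \<cdot>\<^sub>m F k (?c \<cdot>\<^sub>m munit d a b)) $$ (i, j)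
          = complex_of_real (p k) * (?c * (U k * munit d a b * (U k)\<^sup>H) $$ (i, j))"
        using s(1) that carrier_matD[OF s(1)] by (simp del: index_mult_mat)
      then show "(complex_of_real (p k) \<cdot>\<^sub>m F k (?c \<cdot>\<^sub>m munit d a b)) $$ (i, j)
          = ?c * (complex_of_real (p k) * (U k $$ (i, a) * cnj (U k $$ (j, b))))"
        using sandwich_munit_index[OF Uc[OF k] Uc[OF k] that] by simp
    qed simp
    finally show ?thesis by (simp only: sum_distrib_left)
  qed
  have amp: "ampliation d d ?T Z = ?c \<cdot>\<^sub>m (choi d \<Phi> - S)"
  proof (rule eq_matI)
    fix r c assume "r < dim_row (?c \<cdot>\<^sub>m (choi d \<Phi> - S))" "c < dim_col (?c \<cdot>\<^sub>m (choi d \<Phi> - S))"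
    then have rc: "r < ?N" "c < ?N" using S by auto
    note b = pair_index_bounds[OF rc(1)] pair_index_bounds[OF rc(2)]
    let ?E = "munit d (r mod d) (c mod d)"
    have sb: "slot_block d d Z (r mod d) (c mod d) = ?c \<cdot>\<^sub>m ?E"
      using b by (subst slot_block_max_entangled[symmetric])
        (auto simp: slot_block_def Z_def pair_index_less max_entangled_def intro!: eq_matI)
    have "ampliation d d ?T Z $$ (r, c) = (\<Phi> (?c \<cdot>\<^sub>m ?E) - \<Psi> (?c \<cdot>\<^sub>m ?E)) $$ (r div d, c div d)"
      using rc by (simp only: ampliation_def index_mat case_prod_conv sb)
    also have "\<dots> = \<Phi> (?c \<cdot>\<^sub>m ?E) $$ (r div d, c div d) - \<Psi> (?c \<cdot>\<^sub>m ?E) $$ (r div d, c div d)"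
      using \<Psi>1[of "?c \<cdot>\<^sub>m ?E"] b by (intro index_minus_mat) auto
    also have "\<Phi> (?c \<cdot>\<^sub>m ?E) $$ (r div d, c div d) = ?c * choi d \<Phi> $$ (r, c)"
      using rc b module_hom_op_spaceD(1,3)[OF hom, of ?E] by (simp add: choi_index)
    also have "\<Psi> (?c \<cdot>\<^sub>m ?E) $$ (r div d, c div d) = ?c * S $$ (r, c)"
      using rc b by (simp only: \<Psi>2 S_def index_mat case_prod_conv u_def vecop_index)
    also have "?c * choi d \<Phi> $$ (r, c) - ?c * S $$ (r, c) = (?c \<cdot>\<^sub>m (choi d \<Phi> - S)) $$ (r, c)"
      using rc S carrier_matD[OF choi_carrier[of d \<Phi>]] by (simp add: right_diff_distrib)
    finally show "ampliation d d ?T Z $$ (r, c) = (?c \<cdot>\<^sub>m (choi d \<Phi> - S)) $$ (r, c)" .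
  qed (use S in \<open>auto simp: ampliation_def\<close>)
  \<comment> \<open>\<open>R\<close> annihilates the Choi matrix of \<open>\<Phi>\<close>. As
    \<open>- R\<close> is the projection onto the orthogonal complement of the range of
    \<open>P\<close>, the sign makes the pairing with \<open>- S\<close> nonnegative.\<close>
  define R where "R = P - 1\<^sub>m ?N"
  have R: "R \<in> carrier_mat ?N ?N" "R\<^sup>H = R"
    using P by (auto simp: R_def adjoint_minus[of _ ?N ?N])
  have Rv: "(R *\<^sub>v v) \<bullet>c v = (P *\<^sub>v v) \<bullet>c v - v \<bullet>c v" if v: "v \<in> carrier_vec ?N" for v
    using v P(1) mult_mat_vec_carrier[OF P(1) v]
    by (simp add: R_def minus_mult_distrib_mat_vec[of _ ?N ?N] minus_scalar_prod_distrib[of _ ?N])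
  have Pv: "(P *\<^sub>v v) \<bullet>c v = (P *\<^sub>v v) \<bullet>c (P *\<^sub>v v)" if v: "v \<in> carrier_vec ?N" for v
    using adjoint_mult_self_quadratic[OF P(1) v] P by simp
  have RR: "R\<^sup>H * R = 1\<^sub>m ?N - P"
    unfolding R(2) unfolding R_def using P(1,3)
    by (simp add: minus_mult_distrib_mat[of _ ?N ?N _ _ ?N] mult_minus_distrib_mat[of _ ?N ?N _ ?N]
        left_mult_one_mat[of _ ?N ?N] right_mult_one_mat[of _ ?N ?N] minus_carrier_mat)
      (rule eq_matI, auto)
  have Rcon: "contraction ?N R"
    unfolding contraction_def
  proof (intro conjI ballI R(1))
    fix v :: "complex vec" assume v: "v \<in> carrier_vec ?N"
    have "(R *\<^sub>v v) \<bullet>c (R *\<^sub>v v) = ((1\<^sub>m ?N - P) *\<^sub>v v) \<bullet>c v"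
      using adjoint_mult_self_quadratic[OF R(1) v] RR by simp
    also have "\<dots> = v \<bullet>c v - (P *\<^sub>v v) \<bullet>c (P *\<^sub>v v)"
      unfolding Pv[OF v, symmetric] using v P(1) mult_mat_vec_carrier[OF P(1) v]
      by (simp add: minus_mult_distrib_mat_vec[of _ ?N ?N] minus_scalar_prod_distrib[of _ ?N])
    finally show "Re ((R *\<^sub>v v) \<bullet>c (R *\<^sub>v v)) \<le> Re (v \<bullet>c v)"
      using Re_cscalar_prod_self_ge_0[OF mult_mat_vec_carrier[OF P(1) v]] by simp
  qed
  have RS: "mat_trace (R * S) = (\<Sum>k<m. complex_of_real (p k) * ((R *\<^sub>v u k) \<bullet>c u k))"
  proof -
    have "mat_trace (R * S) = (\<Sum>r<?N. \<Sum>c<?N. R $$ (r, c) * S $$ (c, r))"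
      using R(1) S by (subst mat_trace_sum[of _ ?N]) (auto simp: mult_mat_index_sum simp del: index_mult_mat(1))
    also have "\<dots> = (\<Sum>r<?N. \<Sum>c<?N. \<Sum>k<m. complex_of_real (p k) * (R $$ (r, c) * u k $ c * cnj (u k $ r)))"
      by (intro sum.cong refl) (simp add: S_def sum_distrib_left mult_ac)
    also have "\<dots> = (\<Sum>r<?N. \<Sum>k<m. \<Sum>c<?N. complex_of_real (p k) * (R $$ (r, c) * u k $ c * cnj (u k $ r)))"
      by (rule sum.cong[OF refl]) (rule sum.swap)
    also have "\<dots> = (\<Sum>k<m. \<Sum>r<?N. \<Sum>c<?N. complex_of_real (p k) * (R $$ (r, c) * u k $ c * cnj (u k $ r)))"
      by (rule sum.swap)
    also have "\<dots> = (\<Sum>k<m. complex_of_real (p k) * ((R *\<^sub>v u k) \<bullet>c u k))"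
      using R(1) u by (intro sum.cong refl)
        (simp add: cscalar_prod_sum[OF u] mult_mat_vec_index_sum[OF R(1) u] sum_distrib_left sum_distrib_right
          del: index_mult_mat_vec)
    finally show ?thesis .
  qed
  have uu: "u k \<bullet>c u k = of_nat d" if "k < m" for k
    unfolding u_def cscalar_prod_vecop[OF Uc[OF that] Uc[OF that]] using unitary_opsD(2)[OF U[OF that]] by simp
  have c: "R * choi d \<Phi> \<in> carrier_mat ?N ?N" "R * S \<in> carrier_mat ?N ?N"
    using R(1) S by (auto intro: mult_carrier_mat[of _ ?N ?N])
  have Rchoi: "R * choi d \<Phi> = 0\<^sub>m ?N ?N"
    unfolding R_def using P(1,4)
    by (simp add: minus_mult_distrib_mat[of _ ?N ?N _ _ ?N] left_mult_one_mat[of _ ?N ?N] minus_r_inv_mat[of _ ?N ?N])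
  have "R\<^sup>H * ampliation d d ?T Z = ?c \<cdot>\<^sub>m (R * choi d \<Phi> - R * S)"
    unfolding amp R(2) using R(1) S
    by (simp add: mult_smult_distrib[of _ ?N ?N _ ?N] mult_minus_distrib_mat[of _ ?N ?N _ ?N] minus_carrier_mat)
  then have "mat_trace (R\<^sup>H * ampliation d d ?T Z) = ?c * (mat_trace (R * choi d \<Phi>) - mat_trace (R * S))"
  proof -
    have "mat_trace (?c \<cdot>\<^sub>m A) = ?c * mat_trace A" if "A \<in> carrier_mat ?N ?N" for A
      using that by (simp add: mat_trace_def sum_distrib_left)
    moreover assume "R\<^sup>H * ampliation d d ?T Z = ?c \<cdot>\<^sub>m (R * choi d \<Phi> - R * S)"
    ultimately show ?thesis using c by (simp add: mat_trace_diff[of _ ?N] minus_carrier_mat)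
  qed
  also have "mat_trace (R * choi d \<Phi>) = 0" unfolding Rchoi by (simp add: mat_trace_def)
  finally have "Re (mat_trace (R\<^sup>H * ampliation d d ?T Z)) = (\<Sum>k<m. p k * - Re ((R *\<^sub>v u k) \<bullet>c u k)) / d"
    by (simp add: RS sum_negf)
  moreover have "(\<Sum>k<m. p k * (real d * C)) \<le> (\<Sum>k<m. p k * - Re ((R *\<^sub>v u k) \<bullet>c u k))"
  proof (intro sum_mono mult_left_mono)
    fix k assume "k \<in> {..<m}"
    then have k: "k < m" by simp
    show "0 \<le> p k" using p(1) k .
    show "real d * C \<le> - Re ((R *\<^sub>v u k) \<bullet>c u k)"
      using bound[OF U[OF k]] by (simp add: Rv[OF u] uu[OF k]) (simp add: u_def)
  qed
  moreover have "(\<Sum>k<m. p k * (real d * C)) = real d * C"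
    using p(2) by (simp flip: sum_distrib_right)
  ultimately have "C \<le> Re (mat_trace (R\<^sup>H * ampliation d d ?T Z))"
    using d by (simp only: pos_le_divide_eq) (simp add: mult.commute)
  also have "\<dots> \<le> trace_norm (ampliation d d ?T Z)"
    by (rule Re_trace_le_trace_norm[OF _ Rcon]) (simp add: ampliation_def)
  finally have "ereal C \<le> ereal (trace_norm (ampliation d d ?T Z))" by simp
  also have "\<dots> \<le> induced_trace_norm ?N (ampliation d d ?T)"
    unfolding induced_trace_norm_def
    using Z trace_norm_max_entangled[OF d] by (intro SUP_upper) (simp add: Z_def)
  also have "\<dots> \<le> diamond_norm d ?T"
    unfolding diamond_norm_def using d by (intro SUP_upper[of d "{1..}" "\<lambda>n. induced_trace_norm (d * n) (ampliation d n ?T)"]) simp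
  finally show ?thesis by (simp add: channel_dist_def)
qed

theorem lemma2:
  fixes d :: nat and \<Phi> :: "complex mat \<Rightarrow> complex mat"
  assumes "quantum_channel d \<Phi>"
    and "kraus_space d \<Phi> \<inter> unitary_ops d = {}"
  shows "\<exists>C. (\<exists>L\<in>kraus_space d \<Phi>. unitarity_defect d L = C) \<and>
             (\<forall>L\<in>kraus_space d \<Phi>. C \<le> unitarity_defect d L) \<and>
             channel_setdist d \<Phi> (map_convex_hull d (unitary_channels d)) \<ge> ereal C \<and>
             C > 0"
proof -
  let ?N = "d * d"
  define Es where "Es = (SOME Es. kraus_rep d \<Phi> Es)"
  have Es: "kraus_rep d \<Phi> Es" unfolding Es_def by (rule someI_ex) (rule kraus_rep_exists[OF assms(1)])
  define M where "M = kraus_mat d Es"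
  have M: "M \<in> carrier_mat ?N (length Es)" by (simp add: M_def)
  obtain P B where P: "P \<in> carrier_mat ?N ?N" "P\<^sup>H = P" "P * P = P" "P * M = M"
    and B: "B \<in> carrier_mat (length Es) ?N" "P = M * B"
    using range_projection[OF M] by metis
  have K: "kraus_space d \<Phi> = {L \<in> carrier_mat d d. P *\<^sub>v vecop d L = vecop d L}"
    unfolding kraus_space_def Es_def[symmetric]
    using Es P B by (intro span_kraus_mat) (auto simp: kraus_rep_def M_def)
  \<comment> \<open>In dimension 0 the empty matrix is unitary and lies in the Kraus space, against
    the second assumption. Division by \<open>d\<close> is thus harmless.\<close>
  have d: "1 \<le> d"
  proof (rule ccontr)
    assume "\<not> 1 \<le> d"
    then have "d = 0" by simp
    then have "1\<^sub>m d \<in> kraus_space d \<Phi>" "1\<^sub>m d \<in> unitary_ops d"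
      using P(1) unfolding K by (auto intro!: eq_vecI unitary_opsI)
    then show False using assms(2) by blast
  qed
  define g where "g Q = Re ((P *\<^sub>v vecop d Q) \<bullet>c vecop d Q)" for Q
  have Pv: "P *\<^sub>v v \<in> carrier_vec ?N" if "v \<in> carrier_vec ?N" for v
    using P(1) that by (rule mult_mat_vec_carrier)
  have PP: "(P *\<^sub>v v) \<bullet>c (P *\<^sub>v v) = (P *\<^sub>v v) \<bullet>c v" if "v \<in> carrier_vec ?N" for v
    using adjoint_mult_self_quadratic[OF P(1) that] P by simp
  have norm_diff: "Re ((x - y) \<bullet>c (x - y)) = Re (x \<bullet>c x) - 2 * Re (x \<bullet>c y) + Re (y \<bullet>c y)"
    if x: "x \<in> carrier_vec ?N" and y: "y \<in> carrier_vec ?N" for x y :: "complex vec"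
  proof -
    have "(x - y) \<bullet>c (x - y) = (\<Sum>i<?N. x $ i * cnj (x $ i) - x $ i * cnj (y $ i) - y $ i * cnj (x $ i) + y $ i * cnj (y $ i))"
      using x y by (subst cscalar_prod_sum[of _ ?N]) (auto simp: algebra_simps intro!: sum.cong)
    also have "\<dots> = x \<bullet>c x - x \<bullet>c y - y \<bullet>c x + y \<bullet>c y"
      by (simp only: sum.distrib sum_subtractf cscalar_prod_sum[OF x] cscalar_prod_sum[OF y])
    finally show ?thesis using cscalar_prod_commute[OF x y] by simp
  qed
  obtain Q where Q: "contraction d Q" and max: "\<And>R. contraction d R \<Longrightarrow> g R \<le> g Q"
    using contraction_maximizer[OF P(1)] unfolding g_def by blast
  note Qc = contractionD(1)[OF Q]
  \<comment> \<open>For a fixed contraction the optimal value over the Kraus space is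
    \<open>d - g Q\<close>; the chosen \<open>Q\<close> maximizes \<open>g\<close> and so minimizes
    this value.\<close>
  define C where "C = (real d - g Q) / real d"
  define q where "q = vecop d Q"
  have q: "q \<in> carrier_vec ?N" by (simp add: q_def)
  have lower: "C \<le> unitarity_defect d L" if "L \<in> kraus_space d \<Phi>" for L
  proof -
    have L: "L \<in> carrier_mat d d" and PL: "P *\<^sub>v vecop d L = vecop d L" using that by (auto simp: K)
    obtain W where W: "contraction d W" and WL: "mat_abs L = W\<^sup>H * L"
      using mat_abs_eq_contraction_mult[OF L] by metis
    define l w where "l = vecop d L" and "w = vecop d W"
    have l: "l \<in> carrier_vec ?N" and w: "w \<in> carrier_vec ?N" by (simp_all add: l_def w_def)
    have "trace_norm L = Re (l \<bullet>c w)"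
      unfolding trace_norm_def WL l_def w_def cscalar_prod_vecop[OF L contractionD(1)[OF W]] ..
    \<comment> \<open>Since \<open>l\<close> is fixed by the self-adjoint \<open>P\<close>,
      \<open>w\<close> may be replaced by its projection. Completing the square then bounds the
      defect of \<open>L\<close> below by the value for \<open>W\<close>.\<close>
    also have "l \<bullet>c w = l \<bullet>c (P *\<^sub>v w)"
      using cscalar_prod_adjoint[OF P(1) l w] PL P(2) by (simp add: l_def)
    finally have tn: "trace_norm L = Re (l \<bullet>c (P *\<^sub>v w))" .
    have "0 \<le> Re ((l - P *\<^sub>v w) \<bullet>c (l - P *\<^sub>v w))"
      using l Pv[OF w] by (intro Re_cscalar_prod_self_ge_0[of _ ?N]) auto
    also have "\<dots> = Re (l \<bullet>c l) - 2 * trace_norm L + g W"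
      unfolding norm_diff[OF l Pv[OF w]] tn PP[OF w] by (simp add: g_def w_def)
    also have "Re (l \<bullet>c l) = Re (mat_trace (L\<^sup>H * L))"
      unfolding l_def cscalar_prod_vecop[OF L L] ..
    finally show ?thesis
      using max[OF W] by (simp add: unitarity_defect_eq[OF L] C_def divide_right_mono)
  qed
  \<comment> \<open>The minimizer is the projection of \<open>Q\<close> onto the Kraus
    space.\<close>
  define L where "L = unvec d (P *\<^sub>v q)"
  have L: "L \<in> carrier_mat d d" by (simp add: L_def)
  have vL: "vecop d L = P *\<^sub>v q" unfolding L_def using Pv[OF q] by (rule vecop_unvec)
  have "P *\<^sub>v (P *\<^sub>v q) = (P * P) *\<^sub>v q"
    using P(1) q by (intro assoc_mult_mat_vec[symmetric]) auto
  then have LK: "L \<in> kraus_space d \<Phi>" using L P(3) by (simp add: K vL)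
  have "unitarity_defect d L \<le> C"
  proof -
    \<comment> \<open>\<open>Q\<close> competes in the duality for \<open>trace_norm L\<close>; both
      the pairing of \<open>L\<close> with \<open>Q\<close> and the squared norm of \<open>L\<close>
      equal \<open>g Q\<close>.\<close>
    have "Re (mat_trace (Q\<^sup>H * L)) = g Q"
      unfolding cscalar_prod_vecop[OF L Qc, symmetric] vL g_def q_def ..
    then have "g Q \<le> trace_norm L" using Re_trace_le_trace_norm[OF L Q] by simp
    moreover have "Re (mat_trace (L\<^sup>H * L)) = g Q"
      unfolding cscalar_prod_vecop[OF L L, symmetric] vL PP[OF q] by (simp add: g_def q_def)
    ultimately show ?thesis by (simp add: unitarity_defect_eq[OF L] C_def divide_right_mono)
  qed
  then have attained: "unitarity_defect d L = C" using lower[OF LK] by simp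
  \<comment> \<open>Otherwise \<open>g Q \<le> Re (q \<bullet>c q) \<le> d\<close> would be tight
    throughout: the first equality puts \<open>Q\<close> into the Kraus space, the second makes it
    unitary.\<close>
  have "g Q < real d"
  proof (rule ccontr)
    assume "\<not> g Q < real d"
    have tr: "Re (q \<bullet>c q) \<le> real d"
      unfolding q_def cscalar_prod_vecop[OF Qc Qc] by (rule contraction_trace_le[OF Q])
    have "Re ((q - P *\<^sub>v q) \<bullet>c (q - P *\<^sub>v q)) = Re (q \<bullet>c q) - g Q"
      using cscalar_prod_commute[OF q Pv[OF q]]
      unfolding norm_diff[OF q Pv[OF q]] PP[OF q] by (simp add: g_def q_def)
    moreover have "0 \<le> Re ((q - P *\<^sub>v q) \<bullet>c (q - P *\<^sub>v q))"
      using q Pv[OF q] by (intro Re_cscalar_prod_self_ge_0[of _ ?N]) auto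
    ultimately have eq: "Re (q \<bullet>c q) = real d" and 0: "Re ((q - P *\<^sub>v q) \<bullet>c (q - P *\<^sub>v q)) = 0"
      using tr \<open>\<not> g Q < real d\<close> by auto
    have dc: "q - P *\<^sub>v q \<in> carrier_vec ?N" using q Pv[OF q] by auto
    then have z: "q - P *\<^sub>v q = 0\<^sub>v ?N"
      using 0 cscalar_prod_self[OF dc] conjugate_square_eq_0_vec[OF dc] by simp
    have "P *\<^sub>v q = q"
    proof (rule eq_vecI)
      fix i assume i: "i < dim_vec q"
      have "(q - P *\<^sub>v q) $ i = 0" using z i q by simp
      moreover have "(q - P *\<^sub>v q) $ i = q $ i - (P *\<^sub>v q) $ i"
        using i q carrier_vecD[OF Pv[OF q]] by (intro index_minus_vec) auto
      ultimately show "(P *\<^sub>v q) $ i = q $ i" by simp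
    qed (use q P(1) in auto)
    then have "Q \<in> kraus_space d \<Phi>" using Qc by (simp add: K q_def)
    moreover have "mat_trace (Q\<^sup>H * Q) = of_nat d"
      using cscalar_prod_self[OF q] eq cscalar_prod_vecop[OF Qc Qc] by (simp add: q_def)
    then have "Q \<in> unitary_ops d" by (rule contraction_unitaryI[OF Q])
    ultimately show False using assms(2) by blast
  qed
  then have "C > 0" using d by (simp add: C_def)
  moreover have "ereal C \<le> channel_setdist d \<Phi> (map_convex_hull d (unitary_channels d))"
    unfolding channel_setdist_def
  proof (rule INF_greatest)
    fix \<Psi> assume \<Psi>: "\<Psi> \<in> map_convex_hull d (unitary_channels d)"
    show "ereal C \<le> channel_dist d \<Phi> \<Psi>"
    proof (rule mixed_unitary_distance_ge[OF assms(1) d P(1-3) _ _ \<Psi>])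
      show "P * choi d \<Phi> = choi d \<Phi>"
        using M P(1,4) choi_kraus_rep[OF Es] by (simp add: M_def[symmetric] assoc_mult_mat[symmetric, of _ ?N ?N _ "length Es" _ ?N])
      fix U assume "U \<in> unitary_ops d"
      then have "g U \<le> g Q" by (intro max unitary_contraction)
      then show "real d * C \<le> real d - Re ((P *\<^sub>v vecop d U) \<bullet>c vecop d U)"
        using d by (simp add: C_def g_def)
    qed
  qed
  ultimately show ?thesis using attained LK lower by blast
qed

end
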